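(* Assume complete state information, $C^j=I_n$ for all $j\in\mathsf N$. Fix a player $i\in\mathsf N$. Let $r>0$, $\delta^i>0$ and $F^{-i}=(F^j)_{j\ne i}$, $F^j\in\mathbb{R}^{m_j\times n}$, be given, and set $A^i:=A+\sum_{j\ne i}B^jF^j$. For symmetric $Y\in\mathbb{R}^{n\times n}$ define $$\Phi^i(Y):=\begin{bmatrix}-Y&Y{A^i}^\top&(\sqrt{Q^i}Y)^\top&0_{n\times m_i}\\ A^iY&-Y&0_{n\times n}&0_{n\times m_i}\\ \sqrt{Q^i}Y&0_{n\times n}&-I_n&0_{n\times m_i}\\ 0_{m_i\times n}&0_{m_i\times n}&0_{m_i\times n}&-(R^i)^{-1}\end{bmatrix}.$$ Let $\hat B^i:=\begin{bmatrix}0_{m_i\times n}&{B^i}^\top&0_{m_i\times n}&I_{m_i}\end{bmatrix}$ and let $\mathcal N_{\hat B^i}$ be a matrix with orthonormal columns spanning the null space of $\hat B^i$. Define $$\mathscr Y^i:=\Big\{Y\in\mathbb{R}^{n\times n}: Y\succ0,\ Y-\tfrac{r^2}{\delta^i}I_n\succ0,\ \mathcal N_{\hat B^i}^\top\Phi^i(Y)\mathcal N_{\hat B^i}\prec0\Big\},\qquad \mathscr P^i:=\{P^i\in\mathbb{R}^{n\times n}: P^i\succ0,\ (P^i)^{-1}\in\mathscr Y^i\}.$$ Then there exists an $F^i\in\mathfrak g^i(\delta^i,F^{-i})$ (that is, $\mathfrak g^i(\delta^i,F^{-i})\neq\emptyset$), and for any $F^i\in\mathfrak g^i(\delta^i,F^{-i})$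 we have $\sigma(A^i+B^iF^i)\subset\mathbb{D}$, if and only if $\mathscr P^i\ne\emptyset$. In this case, any $F^i\in\mathfrak g^i(\delta^i,F^{-i})$ satisfies the following linear matrix inequality for some $P^i\in\mathscr P^i$: $$\begin{bmatrix}-P^i&(A^i+B^iF^i)^\top P^i&(\sqrt{Q^i})^\top&(\sqrt{R^i}F^i)^\top\\ P^i(A^i+B^iF^i)&-P^i&0_{n\times n}&0_{n\times m_i}\\ \sqrt{Q^i}&0_{n\times n}&-I_n&0_{n\times m_i}\\ \sqrt{R^i}F^i&0_{m_i\times n}&0_{m_i\times n}&-I_{m_i}\end{bmatrix}\prec0.$$
   Context: Players: $\mathsf N=\{1,\dots,N\}$. Discrete-time game with complete state information: $x_{k+1}=Ax_k+\sum_{i\in\mathsf N}B^iu^i_k$, $k\in\{0,1,2,\dots\}$, $A\in\mathbb{R}^{n\times n}$, $B^i\in\mathbb{R}^{n\times m_i}$. In general player $i$ observes $y^i_k=C^ix_k$ and uses $u^i_k=F^iy^i_k$; here $C^i=I_n$, so player $i$ uses state feedback $u^i_k=F^ix_k$, $F^i\in\mathbb{R}^{m_i\times n}$. Weights: $Q^i\in\mathbb{R}^{n\times n}$ symmetric, $Q^i\succeq0$ (positive semidefinite); $R^i\in\mathbb{R}^{m_i\times m_i}$ symmetric, $R^i\succ0$; $\sqrt{Q^i},\sqrt{R^i}$ denote the symmetric positive semidefinite square roots. For an initial condition $x_0\in\mathbb{R}^n$ the cost of player $i$ is $$J^i(F^i,F^{-i})=\sum_{k=0}^\infty x_k^\top\big(Q^i+{F^i}^\top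 R^iF^i\big)x_k,$$ where $x_{k+1}=(A+\sum_{j\in\mathsf N}B^jF^j)x_k$ with initial condition $x_0$. $F^{-i}$ denotes the strategies of all players other than $i$. $\mathbb{D}=\{\lambda\in\mathbb{C}:|\lambda|<1\}$ and $\sigma(\cdot)$ is the spectrum. $M\succ0$ ($M\prec0$) means symmetric positive (negative) definite; $I_m$ and $0_{p\times q}$ are identity and zero matrices. The set of stabilizing profiles $\mathscr F=\{(F^1,\dots,F^N):\sigma(A+\sum_{i\in\mathsf N}B^iF^i)\subset\mathbb{D}\}$ is assumed non-empty. Synthesis is made independent of the specific initial state by assuming only that $x_0\in\{z\in\mathbb{R}^n:\|z\|_2<r\}$, where $r>0$ is a scaling factor. Accordingly, the guaranteed cost response $\mathfrak g^i(\delta^i,F^{-i})$ is the set of $F^i\in\mathbb{R}^{m_i\times n}$ such that $(F^i,F^{-i})\in\mathscr F$ and $J^i(F^i,F^{-i})<\delta^i$ for every initial condition $x_0$ with $\|x_0\|_2<r$.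
   Formalization: The guaranteed cost response requires the supremum of J^i over ‖x_0‖<r to be <δ^i, instead of J^i<δ^i at each such x_0; with the pointwise bound the claim fails when the supremum equals δ^i (e.g. n=m=N=1, A=B=0, Q=R=r=δ=1). *)

theory Defs
  imports
    "HOL-Library.Extended_Real"
    "Jordan_Normal_Form.Matrix_Kernel"
    "Jordan_Normal_Form.Spectral_Radius"
begin

(* Matrices are carrier based because every player has an input dimension m j of its own. *)

definition pos_def :: "real mat \<Rightarrow> bool" where
  "pos_def M \<longleftrightarrow> M\<^sup>T = M \<and>
     (\<forall>x \<in> carrier_vec (dim_row M). x \<noteq> 0\<^sub>v (dim_row M) \<longrightarrow> 0 < x \<bullet> (M *\<^sub>v x))"

definition pos_semidef :: "real mat \<Rightarrow> bool" where
  "pos_semidef M \<longleftrightarrow> M\<^sup>T = M \<and> (\<forall>x \<in> carrier_vec (dim_row M). 0 \<le> x \<bullet> (M *\<^sub>v x))"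

definition neg_def :: "real mat \<Rightarrow> bool" where
  "neg_def M \<longleftrightarrow> M\<^sup>T = M \<and>
     (\<forall>x \<in> carrier_vec (dim_row M). x \<noteq> 0\<^sub>v (dim_row M) \<longrightarrow> x \<bullet> (M *\<^sub>v x) < 0)"

(* A positive semidefinite matrix has exactly one such root, so the choice is immaterial. *)
definition psd_sqrt :: "real mat \<Rightarrow> real mat" where
  "psd_sqrt M = (SOME S. S \<in> carrier_mat (dim_row M) (dim_row M) \<and> pos_semidef S \<and> S * S = M)"

(* Meaningful for invertible matrices only; it is applied to positive definite ones. *)
definition mat_inv :: "real mat \<Rightarrow> real mat" where
  "mat_inv M = the (mat_inverse M)"

definition block_mat4 ::
  "real mat \<Rightarrow> real mat \<Rightarrow> real mat \<Rightarrow> real mat \<Rightarrow>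
   real mat \<Rightarrow> real mat \<Rightarrow> real mat \<Rightarrow> real mat \<Rightarrow>
   real mat \<Rightarrow> real mat \<Rightarrow> real mat \<Rightarrow> real mat \<Rightarrow>
   real mat \<Rightarrow> real mat \<Rightarrow> real mat \<Rightarrow> real mat \<Rightarrow> real mat" where
  "block_mat4 M11 M12 M13 M14
              M21 M22 M23 M24
              M31 M32 M33 M34
              M41 M42 M43 M44 =
     four_block_mat
       (four_block_mat M11 M12 M21 M22) (four_block_mat M13 M14 M23 M24)
       (four_block_mat M31 M32 M41 M42) (four_block_mat M33 M34 M43 M44)"

(* Entrywise, since the type of matrices of all dimensions has no zero and hence no sum. *)
definition input_sum ::
  "nat \<Rightarrow> (nat \<Rightarrow> real mat) \<Rightarrow> (nat \<Rightarrow> real mat) \<Rightarrow> nat set \<Rightarrow> real mat" where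
  "input_sum n B F J = mat n n (\<lambda>(a, b). \<Sum>j\<in>J. (B j * F j) $$ (a, b))"

definition closed_loop ::
  "nat \<Rightarrow> nat \<Rightarrow> real mat \<Rightarrow> (nat \<Rightarrow> real mat) \<Rightarrow> (nat \<Rightarrow> real mat) \<Rightarrow> real mat" where
  "closed_loop n N A B F = A + input_sum n B F {1..N}"

definition schur_stable :: "real mat \<Rightarrow> bool" where
  "schur_stable M \<longleftrightarrow> spectrum (map_mat complex_of_real M) \<subseteq> {z. cmod z < 1}"

definition stabilizing_profiles ::
  "nat \<Rightarrow> (nat \<Rightarrow> nat) \<Rightarrow> nat \<Rightarrow> real mat \<Rightarrow> (nat \<Rightarrow> real mat) \<Rightarrow> (nat \<Rightarrow> real mat) set" where
  "stabilizing_profiles n m N A B =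
     {F. (\<forall>j\<in>{1..N}. F j \<in> carrier_mat (m j) n) \<and> schur_stable (closed_loop n N A B F)}"

fun trajectory :: "real mat \<Rightarrow> real vec \<Rightarrow> nat \<Rightarrow> real vec" where
  "trajectory M x0 0 = x0"
| "trajectory M x0 (Suc k) = M *\<^sub>v trajectory M x0 k"

(* Extended real valued: a divergent series of nonnegative stage costs has value infinity. *)
definition cost ::
  "nat \<Rightarrow> nat \<Rightarrow> real mat \<Rightarrow> (nat \<Rightarrow> real mat) \<Rightarrow> (nat \<Rightarrow> real mat) \<Rightarrow> (nat \<Rightarrow> real mat) \<Rightarrow>
   (nat \<Rightarrow> real mat) \<Rightarrow> nat \<Rightarrow> real vec \<Rightarrow> ereal" where
  "cost n N A B Q R F i x0 =
     (\<Sum>k. ereal (let x = trajectory (closed_loop n N A B F) x0 k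
                  in x \<bullet> ((Q i + (F i)\<^sup>T * R i * F i) *\<^sub>v x)))"

definition initial_states :: "nat \<Rightarrow> real \<Rightarrow> real vec set" where
  "initial_states n r = {z \<in> carrier_vec n. sqrt (z \<bullet> z) < r}"

(* F i is ignored: only the strategies of the other players are taken from F.
   The bound delta is imposed on the worst case over the open ball of initial states. Asking
   only for cost < delta at each of its points would also admit the Fi whose worst case is
   exactly delta (the supremum need not be attained); for these there is no P with
   P < (delta / r^2) I that satisfies the strict matrix inequality. *)
definition guaranteed_response ::
  "nat \<Rightarrow> (nat \<Rightarrow> nat) \<Rightarrow> nat \<Rightarrow> real mat \<Rightarrow> (nat \<Rightarrow> real mat) \<Rightarrow> (nat \<Rightarrow> real mat) \<Rightarrow>
   (nat \<Rightarrow> real mat) \<Rightarrow> real \<Rightarrow> nat \<Rightarrow> real \<Rightarrow> (nat \<Rightarrow> real mat) \<Rightarrow> real mat set" where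
  "guaranteed_response n m N A B Q R r i \<delta> F =
     {Fi \<in> carrier_mat (m i) n.
        F(i := Fi) \<in> stabilizing_profiles n m N A B \<and>
        (SUP x0 \<in> initial_states n r. cost n N A B Q R (F(i := Fi)) i x0) < ereal \<delta>}"

definition Phi :: "nat \<Rightarrow> nat \<Rightarrow> real mat \<Rightarrow> real mat \<Rightarrow> real mat \<Rightarrow> real mat \<Rightarrow> real mat" where
  "Phi n mi Ai Qi Ri Y =
     block_mat4
       (- Y)              (Y * Ai\<^sup>T)    ((psd_sqrt Qi * Y)\<^sup>T)  (0\<^sub>m n mi)
       (Ai * Y)           (- Y)         (0\<^sub>m n n)              (0\<^sub>m n mi)
       (psd_sqrt Qi * Y)  (0\<^sub>m n n)     (- 1\<^sub>m n)              (0\<^sub>m n mi)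
       (0\<^sub>m mi n)         (0\<^sub>m mi n)    (0\<^sub>m mi n)             (- mat_inv Ri)"

(* The block row [0, Bi^T, 0, I], obtained by transposing the corresponding block column. *)
definition B_hat :: "nat \<Rightarrow> nat \<Rightarrow> real mat \<Rightarrow> real mat" where
  "B_hat n mi Bi = (0\<^sub>m n mi @\<^sub>r Bi @\<^sub>r 0\<^sub>m n mi @\<^sub>r 1\<^sub>m mi)\<^sup>T"

definition orthonormal_null_basis :: "real mat \<Rightarrow> real mat \<Rightarrow> bool" where
  "orthonormal_null_basis M K \<longleftrightarrow>
     dim_row K = dim_col M \<and>
     K\<^sup>T * K = 1\<^sub>m (dim_col K) \<and>
     vec_space.col_space (dim_col M) K = mat_kernel M"

definition Y_set ::
  "nat \<Rightarrow> nat \<Rightarrow> real mat \<Rightarrow> real mat \<Rightarrow> real mat \<Rightarrow> real \<Rightarrow> real \<Rightarrow> real mat \<Rightarrow> real mat set" where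
  "Y_set n mi Ai Qi Ri r \<delta> K =
     {Y \<in> carrier_mat n n.
        pos_def Y \<and> pos_def (Y - (r\<^sup>2 / \<delta>) \<cdot>\<^sub>m 1\<^sub>m n) \<and>
        neg_def (K\<^sup>T * Phi n mi Ai Qi Ri Y * K)}"

definition P_set ::
  "nat \<Rightarrow> nat \<Rightarrow> real mat \<Rightarrow> real mat \<Rightarrow> real mat \<Rightarrow> real \<Rightarrow> real \<Rightarrow> real mat \<Rightarrow> real mat set" where
  "P_set n mi Ai Qi Ri r \<delta> K =
     {P \<in> carrier_mat n n. pos_def P \<and> mat_inv P \<in> Y_set n mi Ai Qi Ri r \<delta> K}"

end

theory Submission
  imports Defs
begin

text \<open>Put \<open>M = A\<^sup>i + B\<^sup>i F\<^sup>i\<close>. Both the existence of a guaranteed cost response and the linear matrix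
  inequalities are equivalent to a strict Lyapunov inequality
  \<open>M\<^sup>T P M - P + Q\<^sup>i + F\<^sup>i\<^sup>T R\<^sup>i F\<^sup>i \<prec> 0\<close> with \<open>0 \<prec> P \<prec> (\<delta>\<^sup>i / r\<^sup>2) I\<close>. Such a \<open>P\<close> is a Lyapunov
  function bounding the cost; conversely the cost matrix of a stabilizing gain, increased by a small
  multiple of \<open>\<Sum>\<^sub>k (M\<^sup>k)\<^sup>T M\<^sup>k\<close>, is such a \<open>P\<close>. Completing squares in the quadratic forms replaces the
  Schur complement and turns the Lyapunov inequality into negativity of \<open>\<Phi>\<^sup>i(P\<^sup>-\<^sup>1)\<close> on the kernel of
  \<open>B_hat\<close>; in the other direction the optimal regulator gain for \<open>P\<close> eliminates \<open>F\<^sup>i\<close>.\<close>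

section \<open>Quadratic forms\<close>

text \<open>After congruence by Y = P^-1 and by the inverse root of R, the closed-loop block
  inequality contains the gain only in the cross term 2 (B_hat v) . (F Y a), where a is the first
  block of v. Restricting to the kernel of \<open>B_hat\<close> is therefore exactly what removes
  the unknown F, and passing from P to Y makes the remaining condition affine. Going back, F is
  taken as the minimiser of u . R u + (A x + B u) . P (A x + B u), which is explicit and linear in
  x. Strictness shapes the rest. A supremum over an open ball need not be attained, so pointwise
  strict bounds must be made uniform. A cost matrix is in general only semidefinite and satisfies
  its Lyapunov relation with equality; the gap between the worst cost and \<open>\<delta>\<close>
  pays for the perturbation that repairs both. Spectral decompositions of symmetric matrices are
  replaced by the Cauchy-Schwarz inequality of a semidefinite form. The roots of Q and R, being
  chosen by \<open>SOME\<close>, need an existence proof of their own, by a monotone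
  iteration.\<close>

lemma form_transpose:
  fixes M :: "real mat"
  assumes "M \<in> carrier_mat n k" "x \<in> carrier_vec n" "y \<in> carrier_vec k"
  shows "x \<bullet> (M *\<^sub>v y) = y \<bullet> (M\<^sup>T *\<^sub>v x)"
  using assms transpose_vec_mult_scalar[OF assms(1,3,2)]
  by (metis comm_scalar_prod mult_mat_vec_carrier transpose_carrier_mat)

lemma form_symmetric:
  fixes P :: "real mat"
  assumes "P \<in> carrier_mat n n" "P\<^sup>T = P" "x \<in> carrier_vec n" "y \<in> carrier_vec n"
  shows "x \<bullet> (P *\<^sub>v y) = y \<bullet> (P *\<^sub>v x)"
  using form_transpose[OF assms(1,3,4)] assms(2) by simp

lemma form_sum:
  fixes M :: "real mat"
  assumes "M \<in> carrier_mat n k" "x \<in> carrier_vec n" "y \<in> carrier_vec k"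
  shows "x \<bullet> (M *\<^sub>v y) = (\<Sum>a<n. \<Sum>b<k. x $ a * M $$ (a, b) * y $ b)"
  using assms by (auto simp: scalar_prod_def sum_distrib_left row_def mult.assoc atLeast0LessThan
      intro!: sum.cong)

lemma form_unit:
  fixes M :: "real mat"
  assumes "M \<in> carrier_mat n k" "a < n" "b < k"
  shows "unit_vec n a \<bullet> (M *\<^sub>v unit_vec k b) = M $$ (a, b)"
  using assms by (simp add: scalar_prod_left_unit[of _ n])

lemma smult_mult_mat_vec:
  fixes M :: "'a :: comm_semiring_0 mat"
  assumes "M \<in> carrier_mat n k" "x \<in> carrier_vec k"
  shows "(c \<cdot>\<^sub>m M) *\<^sub>v x = c \<cdot>\<^sub>v (M *\<^sub>v x)"
  using assms by (intro eq_vecI) auto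

lemma smult_transpose_mat: "(c \<cdot>\<^sub>m M)\<^sup>T = c \<cdot>\<^sub>m M\<^sup>T"
  by (intro eq_matI) auto

lemma zero_mult_mat_vec:
  fixes x :: "'a :: semiring_0 vec"
  shows "x \<in> carrier_vec k \<Longrightarrow> 0\<^sub>m n k *\<^sub>v x = 0\<^sub>v n"
  by (intro eq_vecI) auto

lemma smult_smult_mat:
  fixes M :: "'a :: comm_semiring_0 mat"
  shows "c \<cdot>\<^sub>m (d \<cdot>\<^sub>m M) = (c * d) \<cdot>\<^sub>m M"
  by (intro eq_matI) (auto simp: mult.assoc)

lemma form_add_scaled:
  fixes P :: "real mat"
  assumes "P \<in> carrier_mat n n" "P\<^sup>T = P" "x \<in> carrier_vec n" "y \<in> carrier_vec n"
  shows "(x + t \<cdot>\<^sub>v y) \<bullet> (P *\<^sub>v (x + t \<cdot>\<^sub>v y))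
    = x \<bullet> (P *\<^sub>v x) + 2 * t * (x \<bullet> (P *\<^sub>v y)) + t\<^sup>2 * (y \<bullet> (P *\<^sub>v y))"
proof -
  note c = mult_mat_vec_carrier[OF assms(1,3)] mult_mat_vec_carrier[OF assms(1,4)] assms
  have "P *\<^sub>v (x + t \<cdot>\<^sub>v y) = P *\<^sub>v x + t \<cdot>\<^sub>v (P *\<^sub>v y)"
    using c mult_mat_vec[OF assms(1,4)] by (simp add: mult_add_distrib_mat_vec[OF assms(1)])
  then show ?thesis
    using c form_symmetric[OF assms]
    by (simp add: scalar_prod_add_distrib[of _ n] add_scalar_prod_distrib[of _ n]
        algebra_simps power2_eq_square)
qed

lemma scalar_prod_self:
  fixes x :: "real vec"
  shows "x \<bullet> x \<ge> 0" and "x \<in> carrier_vec n \<Longrightarrow> x \<bullet> x = 0 \<longleftrightarrow> x = 0\<^sub>v n"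
proof -
  show "x \<bullet> x \<ge> 0" by (simp add: scalar_prod_def sum_nonneg)
  show "x \<in> carrier_vec n \<Longrightarrow> x \<bullet> x = 0 \<longleftrightarrow> x = 0\<^sub>v n"
    by (auto simp: scalar_prod_def sum_nonneg_eq_0_iff intro!: eq_vecI)
qed

lemma scalar_prod_self_pos:
  fixes x :: "real vec"
  shows "x \<in> carrier_vec n \<Longrightarrow> x \<noteq> 0\<^sub>v n \<Longrightarrow> 0 < x \<bullet> x"
  using scalar_prod_self(1)[of x] scalar_prod_self(2)[of x n] by (simp add: less_le)

lemma mult_mat_zero_vec:
  fixes M :: "'a :: semiring_0 mat"
  shows "M \<in> carrier_mat n k \<Longrightarrow> M *\<^sub>v 0\<^sub>v k = 0\<^sub>v n"
  by (intro eq_vecI) (auto simp: scalar_prod_def)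

lemma pos_def_imp_semidef:
  assumes "P \<in> carrier_mat n n" "pos_def P"
  shows "pos_semidef P"
proof -
  have "0 \<le> x \<bullet> (P *\<^sub>v x)" if "x \<in> carrier_vec n" for x
  proof (cases "x = 0\<^sub>v n")
    case True
    then show ?thesis using mult_mat_vec_carrier[OF assms(1) that] by simp
  next
    case False
    then show ?thesis using assms that unfolding pos_def_def by force
  qed
  then show ?thesis using assms unfolding pos_def_def pos_semidef_def by auto
qed

text \<open>The standard choice t = -b/c settles c > 0. Degenerate and negative leading coefficients
  are treated by explicit values of t, so that the Cauchy-Schwarz inequality also covers forms that
  vanish on nonzero vectors.\<close>

lemma discriminant_le:
  fixes a b c :: real
  assumes "\<And>t. 0 \<le> a + 2 * t * b + t\<^sup>2 * c"
  shows "b\<^sup>2 \<le> a * c"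
proof (cases "c = 0")
  case True
  have "b = 0"
  proof (rule ccontr)
    assume "b \<noteq> 0"
    \<comment> \<open>At this t the affine function a + 2 t b takes the value -1.\<close>
    then show False using assms[of "- (a + 1) / (2 * b)"] True by (simp add: field_simps)
  qed
  then show ?thesis using True by simp
next
  case False
  have "c \<ge> 0"
  proof (rule ccontr)
    assume "\<not> c \<ge> 0"
    \<comment> \<open>Chosen so that t c = -(|a| + 2 |b| - c): one factor t of t^2 c then dominates
      a and 2 t b, and t c < 0 is left over. The summand -c makes t at least 1.\<close>
    define t where "t = (\<bar>a\<bar> + 2 * \<bar>b\<bar> - c) / (- c)"
    have c0: "c < 0" using \<open>\<not> c \<ge> 0\<close> by simp
    have t1: "t \<ge> 1" using c0 by (simp add: t_def field_simps)
    have tc: "t * c = - (\<bar>a\<bar> + 2 * \<bar>b\<bar> - c)" using c0 by (simp add: t_def field_simps)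
    have "t\<^sup>2 * c = - (t * (\<bar>a\<bar> + 2 * \<bar>b\<bar> - c))"
      by (simp only: power2_eq_square mult.assoc tc mult_minus_right)
    moreover have "t * b \<le> t * \<bar>b\<bar>" using t1 by (intro mult_left_mono) auto
    moreover have "\<bar>a\<bar> \<le> t * \<bar>a\<bar>" using t1 mult_right_mono[of 1 t "\<bar>a\<bar>"] by simp
    moreover have "t * c < 0" using t1 c0 by (simp add: mult_pos_neg)
    ultimately have "a + 2 * t * b + t\<^sup>2 * c < 0" by (simp add: algebra_simps)
    then show False using assms[of t] by simp
  qed
  then have "c > 0" using False by simp
  \<comment> \<open>The minimiser of the quadratic, where its value is a - b^2 / c.\<close>
  moreover have "0 \<le> a + 2 * (- b / c) * b + (- b / c)\<^sup>2 * c" using assms .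
  ultimately show ?thesis by (simp add: field_simps power2_eq_square)
qed

lemma form_Cauchy_Schwarz:
  assumes "P \<in> carrier_mat n n" "pos_semidef P" "x \<in> carrier_vec n" "y \<in> carrier_vec n"
  shows "(x \<bullet> (P *\<^sub>v y))\<^sup>2 \<le> (x \<bullet> (P *\<^sub>v x)) * (y \<bullet> (P *\<^sub>v y))"
proof (rule discriminant_le)
  fix t
  have "P\<^sup>T = P" and "0 \<le> (x + t \<cdot>\<^sub>v y) \<bullet> (P *\<^sub>v (x + t \<cdot>\<^sub>v y))"
    using assms unfolding pos_semidef_def by auto
  then show "0 \<le> x \<bullet> (P *\<^sub>v x) + 2 * t * (x \<bullet> (P *\<^sub>v y)) + t\<^sup>2 * (y \<bullet> (P *\<^sub>v y))"
    using form_add_scaled assms by simp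
qed

lemma pos_semidef_one: "pos_semidef (1\<^sub>m n)"
  by (auto simp: pos_semidef_def scalar_prod_self)

lemma Cauchy_Schwarz_vec:
  fixes x y :: "real vec"
  assumes "x \<in> carrier_vec n" "y \<in> carrier_vec n"
  shows "(x \<bullet> y)\<^sup>2 \<le> (x \<bullet> x) * (y \<bullet> y)"
  using form_Cauchy_Schwarz[OF one_carrier_mat pos_semidef_one assms] assms by simp

text \<open>A crude substitute for the largest eigenvalue: every |x_a x_b| is at most x . x, so the
  sum of the absolute entries bounds the form. Adding 1 makes the constant positive, as later
  divisions by it require.\<close>

lemma form_bounded:
  fixes M :: "real mat"
  assumes "M \<in> carrier_mat n n"
  shows "\<exists>c>0. \<forall>x\<in>carrier_vec n. x \<bullet> (M *\<^sub>v x) \<le> c * (x \<bullet> x)"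
proof (intro exI conjI ballI)
  let ?s = "\<Sum>a<n. \<Sum>b<n. \<bar>M $$ (a, b)\<bar>"
  have "?s \<ge> 0" by (simp add: sum_nonneg)
  then show "1 + ?s > 0" by simp
  fix x :: "real vec" assume x: "x \<in> carrier_vec n"
  have sq: "(x $ a)\<^sup>2 \<le> x \<bullet> x" if "a < n" for a
    using x that by (auto simp: scalar_prod_def power2_eq_square intro!: member_le_sum)
  have "x $ a * M $$ (a, b) * x $ b \<le> \<bar>M $$ (a, b)\<bar> * (x \<bullet> x)" if "a < n" "b < n" for a b
  proof -
    have "\<bar>x $ a * x $ b\<bar> \<le> ((x $ a)\<^sup>2 + (x $ b)\<^sup>2) / 2"
      using sum_squares_bound[of "\<bar>x $ a\<bar>" "\<bar>x $ b\<bar>"] by (simp add: abs_mult)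
    also have "\<dots> \<le> x \<bullet> x" using sq[OF that(1)] sq[OF that(2)] by simp
    finally have "\<bar>M $$ (a, b)\<bar> * \<bar>x $ a * x $ b\<bar> \<le> \<bar>M $$ (a, b)\<bar> * (x \<bullet> x)"
      by (intro mult_left_mono) auto
    moreover have "x $ a * M $$ (a, b) * x $ b \<le> \<bar>x $ a * M $$ (a, b) * x $ b\<bar>" by simp
    ultimately show ?thesis by (simp add: abs_mult mult_ac)
  qed
  then have "x \<bullet> (M *\<^sub>v x) \<le> ?s * (x \<bullet> x)"
    unfolding form_sum[OF assms x x] sum_distrib_right by (intro sum_mono) auto
  then show "x \<bullet> (M *\<^sub>v x) \<le> (1 + ?s) * (x \<bullet> x)"
    using scalar_prod_self(1)[of x] by (simp add: algebra_simps)
qed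

lemma symmetric_eqI:
  assumes "M \<in> carrier_mat n n" "\<And>a b. a < n \<Longrightarrow> b < n \<Longrightarrow> M $$ (a, b) = M $$ (b, a)"
  shows "M\<^sup>T = M"
  using assms by (intro eq_matI) auto

section \<open>Square roots of positive semidefinite matrices\<close>

text \<open>The polynomials in X with nonnegative coefficients, as a set of matrices. A product of
  two positive semidefinite matrices need not be semidefinite, but this cone inside the algebra of X
  is closed under products and consists of semidefinite matrices when X is one.\<close>

inductive_set nonneg_polys :: "nat \<Rightarrow> real mat \<Rightarrow> real mat set" for n X where
  zero: "0\<^sub>m n n \<in> nonneg_polys n X"
| add_power: "M \<in> nonneg_polys n X \<Longrightarrow> a \<ge> 0 \<Longrightarrow> a \<cdot>\<^sub>m (X ^\<^sub>m k) + M \<in> nonneg_polys n X"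

lemma pow_mat_Suc_left:
  assumes "X \<in> carrier_mat n n"
  shows "X ^\<^sub>m Suc k = X * X ^\<^sub>m k"
  using assms by (induction k) (auto simp: assoc_mult_mat[of _ n n _ n _ n])

lemma pow_mat_add:
  assumes "X \<in> carrier_mat n n"
  shows "X ^\<^sub>m (j + k) = X ^\<^sub>m j * X ^\<^sub>m k"
  using assms by (induction k) (auto simp: assoc_mult_mat[of _ n n _ n _ n])

lemma pow_mat_transpose:
  fixes X :: "real mat"
  assumes "X \<in> carrier_mat n n"
  shows "(X ^\<^sub>m k)\<^sup>T = (X\<^sup>T) ^\<^sub>m k"
proof (induction k)
  case (Suc k)
  have "(X ^\<^sub>m Suc k)\<^sup>T = X\<^sup>T * (X ^\<^sub>m k)\<^sup>T"
    using assms by (simp add: transpose_mult[of _ n n _ n])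
  then show ?case using Suc pow_mat_Suc_left[of "X\<^sup>T" n k] assms by simp
qed (use assms in auto)

text \<open>With j = k div 2 and y = X^j x, the form of X^k at x is y . y for even k and y . X y for
  odd k.\<close>

lemma pos_semidef_power:
  assumes X: "X \<in> carrier_mat n n" and psd: "pos_semidef X"
  shows "pos_semidef (X ^\<^sub>m k)"
proof -
  have T: "X\<^sup>T = X" using psd by (simp add: pos_semidef_def)
  have pT: "(X ^\<^sub>m j)\<^sup>T = X ^\<^sub>m j" for j using pow_mat_transpose[OF X] T by simp
  have pc: "X ^\<^sub>m j \<in> carrier_mat n n" for j using X by simp
  have "0 \<le> x \<bullet> (X ^\<^sub>m k *\<^sub>v x)" if x: "x \<in> carrier_vec n" for x
  proof -
    define j where "j = k div 2"
    have y: "X ^\<^sub>m j *\<^sub>v x \<in> carrier_vec n" using mult_mat_vec_carrier[OF pc x] .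
    have *: "x \<bullet> (X ^\<^sub>m j *\<^sub>v z) = (X ^\<^sub>m j *\<^sub>v x) \<bullet> z" if "z \<in> carrier_vec n" for z
      using form_symmetric[OF pc pT x that] comm_scalar_prod[OF y that] by simp
    consider "k = j + j" | "k = j + (1 + j)" unfolding j_def by linarith
    then show ?thesis
    proof cases
      case 1
      have "X ^\<^sub>m k *\<^sub>v x = X ^\<^sub>m j *\<^sub>v (X ^\<^sub>m j *\<^sub>v x)"
        using 1 pow_mat_add[OF X, of j j] pc x by (simp add: assoc_mult_mat_vec[of _ n n _ n])
      then show ?thesis using *[OF y] scalar_prod_self(1) by simp
    next
      case 2
      have "X ^\<^sub>m k *\<^sub>v x = X ^\<^sub>m j *\<^sub>v (X *\<^sub>v (X ^\<^sub>m j *\<^sub>v x))"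
        using 2 pow_mat_add[OF X, of j "1 + j"] pow_mat_Suc_left[OF X, of j] pc x X
        by (simp add: assoc_mult_mat_vec[of _ n n _ n])
      then show ?thesis using *[of "X *\<^sub>v (X ^\<^sub>m j *\<^sub>v x)"] psd y X by (auto simp: pos_semidef_def)
    qed
  qed
  then show ?thesis using pT X by (simp add: pos_semidef_def)
qed

context
  fixes n :: nat and X :: "real mat"
  assumes X: "X \<in> carrier_mat n n" and psd: "pos_semidef X"
begin

lemma nonneg_polys_carrier: "M \<in> nonneg_polys n X \<Longrightarrow> M \<in> carrier_mat n n"
  by (induction rule: nonneg_polys.induct) (use X in auto)

lemma nonneg_polys_add:
  "M \<in> nonneg_polys n X \<Longrightarrow> L \<in> nonneg_polys n X \<Longrightarrow> M + L \<in> nonneg_polys n X"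
proof (induction rule: nonneg_polys.induct)
  case zero
  then show ?case using nonneg_polys_carrier by simp
next
  case (add_power M a k)
  have "a \<cdot>\<^sub>m X ^\<^sub>m k + M + L = a \<cdot>\<^sub>m X ^\<^sub>m k + (M + L)"
    using X nonneg_polys_carrier[OF add_power(1)] nonneg_polys_carrier[OF add_power(4)]
    by (intro assoc_add_mat) auto
  then show ?case using nonneg_polys.add_power add_power by simp
qed

lemma nonneg_polys_smult:
  "M \<in> nonneg_polys n X \<Longrightarrow> c \<ge> 0 \<Longrightarrow> c \<cdot>\<^sub>m M \<in> nonneg_polys n X"
proof (induction rule: nonneg_polys.induct)
  case (add_power M a k)
  have "c \<cdot>\<^sub>m (a \<cdot>\<^sub>m X ^\<^sub>m k + M) = (c * a) \<cdot>\<^sub>m X ^\<^sub>m k + c \<cdot>\<^sub>m M"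
    using X nonneg_polys_carrier[OF add_power(1)]
    by (intro eq_matI) (auto simp: algebra_simps)
  then show ?case using nonneg_polys.add_power add_power by simp
qed (simp add: nonneg_polys.zero)

lemma nonneg_polys_power: "X ^\<^sub>m k \<in> nonneg_polys n X"
proof -
  have "1 \<cdot>\<^sub>m X ^\<^sub>m k + 0\<^sub>m n n = X ^\<^sub>m k" using X by (intro eq_matI) auto
  then show ?thesis using nonneg_polys.add_power[OF nonneg_polys.zero, of 1 X k n] by simp
qed

lemma nonneg_polys_power_mult:
  "M \<in> nonneg_polys n X \<Longrightarrow> X ^\<^sub>m j * M \<in> nonneg_polys n X"
proof (induction rule: nonneg_polys.induct)
  case zero
  then show ?case using X nonneg_polys.zero by (simp add: right_mult_zero_mat[of _ n n])
next
  case (add_power M a k)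
  have "X ^\<^sub>m j * (a \<cdot>\<^sub>m X ^\<^sub>m k + M) = a \<cdot>\<^sub>m X ^\<^sub>m (j + k) + X ^\<^sub>m j * M"
    using X nonneg_polys_carrier[OF add_power(1)] pow_mat_add[OF X, of j k]
    by (simp add: mult_add_distrib_mat[of _ n n _ n] mult_smult_distrib[of _ n n _ n])
  then show ?case using nonneg_polys.add_power add_power by simp
qed

lemma nonneg_polys_mult:
  "M \<in> nonneg_polys n X \<Longrightarrow> L \<in> nonneg_polys n X \<Longrightarrow> M * L \<in> nonneg_polys n X"
proof (induction rule: nonneg_polys.induct)
  case zero
  then show ?case
    using nonneg_polys_carrier nonneg_polys.zero by (simp add: left_mult_zero_mat[of _ n n])
next
  case (add_power M a k)
  have "(a \<cdot>\<^sub>m X ^\<^sub>m k + M) * L = a \<cdot>\<^sub>m (X ^\<^sub>m k * L) + M * L"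
    using X nonneg_polys_carrier[OF add_power(1)] nonneg_polys_carrier[OF add_power(4)]
    by (simp add: add_mult_distrib_mat[of _ n n _ _ n] mult_smult_assoc_mat[of _ n n _ n])
  then show ?case
    using nonneg_polys_power_mult nonneg_polys_add nonneg_polys_smult add_power by simp
qed

lemma nonneg_polys_psd: "M \<in> nonneg_polys n X \<Longrightarrow> pos_semidef M"
proof (induction rule: nonneg_polys.induct)
  case zero
  then show ?case by (auto simp: pos_semidef_def zero_mult_mat_vec)
next
  case (add_power M a k)
  have c: "M \<in> carrier_mat n n" "X ^\<^sub>m k \<in> carrier_mat n n"
    using X nonneg_polys_carrier add_power by auto
  have p: "pos_semidef (X ^\<^sub>m k)" using pos_semidef_power X psd by simp
  have "(a \<cdot>\<^sub>m X ^\<^sub>m k + M)\<^sup>T = a \<cdot>\<^sub>m X ^\<^sub>m k + M"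
    using c p add_power(3) unfolding pos_semidef_def
    by (simp add: transpose_add[of _ n n] smult_transpose_mat)
  moreover have "x \<bullet> ((a \<cdot>\<^sub>m X ^\<^sub>m k + M) *\<^sub>v x) \<ge> 0" if x: "x \<in> carrier_vec n" for x
  proof -
    have "x \<bullet> ((a \<cdot>\<^sub>m X ^\<^sub>m k + M) *\<^sub>v x) = a * (x \<bullet> (X ^\<^sub>m k *\<^sub>v x)) + x \<bullet> (M *\<^sub>v x)"
      using c x by (simp add: add_mult_distrib_mat_vec[of _ n n] scalar_prod_add_distrib[of _ n]
          smult_mult_mat_vec[of _ n n])
    then show ?thesis using p add_power(2,3) c x unfolding pos_semidef_def by auto
  qed
  ultimately show ?case using c by (auto simp: pos_semidef_def)
qed

text \<open>Products stay in the cone and are therefore symmetric, so M L = (M L)^T = L^T M^T = L M;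
  this spares a double induction over the coefficients.\<close>

lemma nonneg_polys_commute:
  assumes "M \<in> nonneg_polys n X" "L \<in> nonneg_polys n X"
  shows "M * L = L * M"
proof -
  have "(M * L)\<^sup>T = M * L" "M\<^sup>T = M" "L\<^sup>T = L"
    using nonneg_polys_psd[OF nonneg_polys_mult] nonneg_polys_psd assms
    unfolding pos_semidef_def by auto
  then show ?thesis using nonneg_polys_carrier assms transpose_mult by metis
qed

end

text \<open>Picard iteration for 2 L = X + L^2, that is, (1 - L)^2 = 1 - X. Starting at 0 puts all
  iterates, and the first difference X / 2, into the cone \<open>nonneg_polys\<close>.\<close>

fun sqrt_iter :: "nat \<Rightarrow> real mat \<Rightarrow> nat \<Rightarrow> real mat" where
  "sqrt_iter n X 0 = 0\<^sub>m n n"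
| "sqrt_iter n X (Suc k) = (1 / 2) \<cdot>\<^sub>m (X + sqrt_iter n X k * sqrt_iter n X k)"

text \<open>That 0 <= Z <= 1 implies Z^2 <= 1, without eigenvalues. For y = Z x the Cauchy-Schwarz
  inequality of the form of Z gives (y . y)^2 <= (y . Z y) (x . Z x) <= (y . y) (x . x), and y . y
  cancels unless it is zero. It keeps the square root iteration below the identity.\<close>

lemma form_le_self_imp_square_le:
  assumes Z: "Z \<in> carrier_mat n n" "pos_semidef Z" and x: "x \<in> carrier_vec n"
    and le: "\<And>y. y \<in> carrier_vec n \<Longrightarrow> y \<bullet> (Z *\<^sub>v y) \<le> y \<bullet> y"
  shows "(Z *\<^sub>v x) \<bullet> (Z *\<^sub>v x) \<le> x \<bullet> x"
proof -
  let ?y = "Z *\<^sub>v x"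
  have y: "?y \<in> carrier_vec n" using Z x by simp
  have T: "Z\<^sup>T = Z" using Z by (simp add: pos_semidef_def)
  have "(?y \<bullet> ?y)\<^sup>2 \<le> (?y \<bullet> (Z *\<^sub>v ?y)) * (x \<bullet> (Z *\<^sub>v x))"
    using form_Cauchy_Schwarz[OF Z y x] .
  also have "\<dots> \<le> (?y \<bullet> ?y) * (x \<bullet> x)"
    using le[OF y] le[OF x] Z x y scalar_prod_self(1)
    by (intro mult_mono) (auto simp: pos_semidef_def)
  finally show ?thesis
    using scalar_prod_self(1)[of ?y] scalar_prod_self(1)[of x]
    by (cases "?y \<bullet> ?y = 0") (auto simp: power2_eq_square)
qed

lemma form_limit:
  fixes Z :: "nat \<Rightarrow> real mat"
  assumes "\<And>k. Z k \<in> carrier_mat n n" "L \<in> carrier_mat n n"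
    and "\<And>a b. a < n \<Longrightarrow> b < n \<Longrightarrow> (\<lambda>k. Z k $$ (a, b)) \<longlonglongrightarrow> L $$ (a, b)"
    and x: "x \<in> carrier_vec n" "y \<in> carrier_vec n"
  shows "(\<lambda>k. x \<bullet> (Z k *\<^sub>v y)) \<longlonglongrightarrow> x \<bullet> (L *\<^sub>v y)"
  unfolding form_sum[OF assms(1) x] form_sum[OF assms(2) x]
  by (intro tendsto_sum tendsto_mult assms(3)) auto

text \<open>The square root of \<open>1 - X\<close> is \<open>1 - L\<close>, where \<open>L = (X + L\<^sup>2) / 2\<close> is the limit of the
  iteration. The differences of consecutive iterates are polynomials in \<open>X\<close> with
  nonnegative coefficients, which makes the iteration monotone.\<close>

lemma sqrt_iter_limit:
  assumes X: "X \<in> carrier_mat n n" and psd: "pos_semidef X"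
    and le: "\<And>x. x \<in> carrier_vec n \<Longrightarrow> x \<bullet> (X *\<^sub>v x) \<le> x \<bullet> x"
  shows "\<exists>L\<in>carrier_mat n n. pos_semidef L \<and> (\<forall>x\<in>carrier_vec n. x \<bullet> (L *\<^sub>v x) \<le> x \<bullet> x)
    \<and> L = (1 / 2) \<cdot>\<^sub>m (X + L * L)"
proof -
  let ?Z = "sqrt_iter n X"
  note polys = nonneg_polys_carrier[OF X psd] nonneg_polys_add[OF X psd]
    nonneg_polys_smult[OF X psd] nonneg_polys_mult[OF X psd]
  have X1: "X \<in> nonneg_polys n X" using nonneg_polys_power[OF X psd, of 1] X by simp
  have Zpoly: "?Z k \<in> nonneg_polys n X" for k
    by (induction k) (auto intro!: polys X1 nonneg_polys.zero)
  have Z: "?Z k \<in> carrier_mat n n" for k using polys(1) Zpoly by simp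
  have Zpsd: "pos_semidef (?Z k)" for k using nonneg_polys_psd[OF X psd Zpoly] .
  have ZT: "(?Z k)\<^sup>T = ?Z k" for k using Zpsd by (simp add: pos_semidef_def)
  have diff: "?Z (Suc k) - ?Z k \<in> nonneg_polys n X" for k
  proof (induction k)
    case 0
    have "?Z (Suc 0) - ?Z 0 = (1 / 2) \<cdot>\<^sub>m X" using X by (intro eq_matI) auto
    then show ?case using polys X1 by simp
  next
    case (Suc k)
    let ?S = "?Z (Suc k)" and ?T = "?Z k"
    \<comment> \<open>Because the iterates commute, S^2 - T^2 factors as (S - T) (S + T); the
      induction hypothesis covers the first factor and closure under sums the second.\<close>
    have comm: "?S * ?T = ?T * ?S" using nonneg_polys_commute[OF X psd Zpoly Zpoly] .
    have "(?S - ?T) * (?S + ?T) = ?S * (?S + ?T) - ?T * (?S + ?T)"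
      using Z by (intro minus_mult_distrib_mat[of _ n n _ _ n]) (auto simp del: sqrt_iter.simps)
    also have "\<dots> = (?S * ?S + ?S * ?T) - (?T * ?S + ?T * ?T)"
      using Z by (simp add: mult_add_distrib_mat[of _ n n _ n] del: sqrt_iter.simps)
    finally have *: "(?S - ?T) * (?S + ?T) = (?S * ?S + ?S * ?T) - (?T * ?S + ?T * ?T)" .
    have "?Z (Suc (Suc k)) - ?S
      = (1 / 2) \<cdot>\<^sub>m (X + ?S * ?S) - (1 / 2) \<cdot>\<^sub>m (X + ?T * ?T)"
      by (subst sqrt_iter.simps(2)[of n X "Suc k"], subst (4) sqrt_iter.simps(2)) simp
    also have "\<dots> = (1 / 2) \<cdot>\<^sub>m ((?S - ?T) * (?S + ?T))"
      unfolding * comm using X Z[of k] Z[of "Suc k"]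
      by (intro eq_matI) (auto simp: algebra_simps diff_divide_distrib add_divide_distrib
          simp del: sqrt_iter.simps)
    finally have eq: "?Z (Suc (Suc k)) - ?S = (1 / 2) \<cdot>\<^sub>m ((?S - ?T) * (?S + ?T))" .
    show ?case unfolding eq by (intro polys Suc Zpoly) simp
  qed
  \<comment> \<open>The form of the next iterate is the mean of x . X x and the squared length of
    \<open>?Z k *\<^sub>v x\<close>, both at most x . x.\<close>
  have bound: "x \<bullet> (?Z k *\<^sub>v x) \<le> x \<bullet> x" if "x \<in> carrier_vec n" for k x
    using that
  proof (induction k arbitrary: x)
    case 0
    then show ?case using scalar_prod_self(1) by (simp add: zero_mult_mat_vec)
  next
    case (Suc k)
    let ?y = "?Z k *\<^sub>v x"
    have y: "?y \<in> carrier_vec n" using mult_mat_vec_carrier[OF Z Suc(2)] .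
    have "?Z (Suc k) *\<^sub>v x = (1 / 2) \<cdot>\<^sub>v (X *\<^sub>v x + ?Z k *\<^sub>v ?y)"
      using X mult_carrier_mat[OF Z Z, of k k] Suc(2) assoc_mult_mat_vec[OF Z Z Suc(2), of k k]
      by (simp add: smult_mult_mat_vec[of _ n n] add_mult_distrib_mat_vec[of _ n n])
    then have "x \<bullet> (?Z (Suc k) *\<^sub>v x) = (x \<bullet> (X *\<^sub>v x) + x \<bullet> (?Z k *\<^sub>v ?y)) / 2"
      using mult_mat_vec_carrier[OF X Suc(2)] mult_mat_vec_carrier[OF Z y, of k] Suc(2)
      by (simp add: scalar_prod_add_distrib[of _ n] del: sqrt_iter.simps)
    also have "x \<bullet> (?Z k *\<^sub>v ?y) = ?y \<bullet> ?y"
      using form_symmetric[OF Z ZT Suc(2) y] .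
    also have "\<dots> \<le> x \<bullet> x"
      using form_le_self_imp_square_le[OF Z Zpsd Suc(2) Suc(1)] .
    also have "x \<bullet> (X *\<^sub>v x) \<le> x \<bullet> x" using le Suc by simp
    finally show ?case by simp
  qed
  have conv: "convergent (\<lambda>k. x \<bullet> (?Z k *\<^sub>v x))" if x: "x \<in> carrier_vec n" for x
  proof -
    have "x \<bullet> (?Z k *\<^sub>v x) \<le> x \<bullet> (?Z (Suc k) *\<^sub>v x)" for k
    proof -
      have "0 \<le> x \<bullet> ((?Z (Suc k) - ?Z k) *\<^sub>v x)"
        using nonneg_polys_psd[OF X psd diff] x Z[of k] unfolding pos_semidef_def
        by (auto simp del: sqrt_iter.simps)
      then show ?thesis using Z[of k] Z[of "Suc k"] x
        by (simp add: minus_mult_distrib_mat_vec[of _ n n] scalar_prod_minus_distrib[of _ n]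
            del: sqrt_iter.simps)
    qed
    then have "incseq (\<lambda>k. x \<bullet> (?Z k *\<^sub>v x))" by (intro incseq_SucI)
    then obtain l where "(\<lambda>k. x \<bullet> (?Z k *\<^sub>v x)) \<longlonglongrightarrow> l"
      using incseq_convergent[of _ "x \<bullet> x"] bound[OF x] by metis
    then show ?thesis by (auto simp: convergent_def)
  qed
  \<comment> \<open>Monotonicity makes only quadratic forms converge. Polarization at unit vectors
    transfers this to the individual entries.\<close>
  have polar: "x \<bullet> (?Z k *\<^sub>v y)
      = ((x + y) \<bullet> (?Z k *\<^sub>v (x + y)) - x \<bullet> (?Z k *\<^sub>v x) - y \<bullet> (?Z k *\<^sub>v y)) / 2"
    if "x \<in> carrier_vec n" "y \<in> carrier_vec n" for x y k
    using form_add_scaled[OF Z ZT that, where t = 1] by simp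
  have "convergent (\<lambda>k. ?Z k $$ (a, b))" if "a < n" "b < n" for a b
  proof -
    let ?x = "unit_vec n a :: real vec" and ?y = "unit_vec n b :: real vec"
    have c: "?x \<in> carrier_vec n" "?y \<in> carrier_vec n" "?x + ?y \<in> carrier_vec n" by auto
    have "(\<lambda>k. ?Z k $$ (a, b)) = (\<lambda>k. ((?x + ?y) \<bullet> (?Z k *\<^sub>v (?x + ?y))
        - ?x \<bullet> (?Z k *\<^sub>v ?x) - ?y \<bullet> (?Z k *\<^sub>v ?y)) / 2)"
      using form_unit[OF Z that] polar[OF c(1,2)] by simp
    moreover obtain l1 l2 l3 where "(\<lambda>k. ?x \<bullet> (?Z k *\<^sub>v ?x)) \<longlonglongrightarrow> l1" "(\<lambda>k. ?y \<bullet> (?Z k *\<^sub>v ?y)) \<longlonglongrightarrow> l2"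
      "(\<lambda>k. (?x + ?y) \<bullet> (?Z k *\<^sub>v (?x + ?y))) \<longlonglongrightarrow> l3"
      using conv[OF c(1)] conv[OF c(2)] conv[OF c(3)] unfolding convergent_def by blast
    then have "(\<lambda>k. ((?x + ?y) \<bullet> (?Z k *\<^sub>v (?x + ?y))
        - ?x \<bullet> (?Z k *\<^sub>v ?x) - ?y \<bullet> (?Z k *\<^sub>v ?y)) / 2) \<longlonglongrightarrow> (l3 - l1 - l2) / 2"
      by (intro tendsto_intros) auto
    ultimately show ?thesis by (auto simp: convergent_def)
  qed
  define L where "L = mat n n (\<lambda>ab. lim (\<lambda>k. ?Z k $$ ab))"
  have L: "L \<in> carrier_mat n n" by (simp add: L_def)
  have lim: "(\<lambda>k. ?Z k $$ (a, b)) \<longlonglongrightarrow> L $$ (a, b)" if "a < n" "b < n" for a b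
    using \<open>\<And>b a. a < n \<Longrightarrow> b < n \<Longrightarrow> convergent (\<lambda>k. ?Z k $$ (a, b))\<close>[OF that] that
    by (simp add: L_def convergent_LIMSEQ_iff)
  have "L\<^sup>T = L"
  proof (rule symmetric_eqI[OF L])
    fix a b assume ab: "a < n" "b < n"
    have "?Z k $$ (a, b) = ?Z k $$ (b, a)" for k
      using ab ZT[of k] Z[of k] index_transpose_mat(1)[of b "?Z k" a] by auto
    then show "L $$ (a, b) = L $$ (b, a)"
      using lim[OF ab] lim[OF ab(2,1)] LIMSEQ_unique by simp
  qed
  moreover have "0 \<le> x \<bullet> (L *\<^sub>v x)" "x \<bullet> (L *\<^sub>v x) \<le> x \<bullet> x" if x: "x \<in> carrier_vec n" for x
  proof -
    have l: "(\<lambda>k. x \<bullet> (?Z k *\<^sub>v x)) \<longlonglongrightarrow> x \<bullet> (L *\<^sub>v x)"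
      by (rule form_limit[OF Z L _ x x]) (rule lim)
    show "0 \<le> x \<bullet> (L *\<^sub>v x)"
    proof (rule LIMSEQ_le_const[OF l], intro exI allI impI)
      show "0 \<le> x \<bullet> (?Z k *\<^sub>v x)" for k
        using Zpsd[of k] x unfolding pos_semidef_def carrier_matD(1)[OF Z] by blast
    qed
    show "x \<bullet> (L *\<^sub>v x) \<le> x \<bullet> x"
      using LIMSEQ_le_const2[OF l] bound[OF x] by auto
  qed
  moreover have "L = (1 / 2) \<cdot>\<^sub>m (X + L * L)"
  proof (rule eq_matI)
    fix a b assume "a < dim_row ((1 / 2) \<cdot>\<^sub>m (X + L * L))" "b < dim_col ((1 / 2) \<cdot>\<^sub>m (X + L * L))"
    then have ab: "a < n" "b < n" using X L by auto
    have prod: "(M * M) $$ (a, b) = (\<Sum>c<n. M $$ (a, c) * M $$ (c, b))"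
      if "M \<in> carrier_mat n n" for M :: "real mat"
      using that ab by (auto simp: scalar_prod_def atLeast0LessThan)
    have "(\<lambda>k. (X $$ (a, b) + (?Z k * ?Z k) $$ (a, b)) / 2)
        \<longlonglongrightarrow> (X $$ (a, b) + (L * L) $$ (a, b)) / 2"
      unfolding prod[OF Z] prod[OF L] 
      by (use ab in \<open>auto intro!: tendsto_intros lim\<close>)
    moreover have "?Z (Suc k) $$ (a, b) = (X $$ (a, b) + (?Z k * ?Z k) $$ (a, b)) / 2" for k
      using X Z[of k] ab by simp
    ultimately have "(\<lambda>k. ?Z (Suc k) $$ (a, b)) \<longlonglongrightarrow> (X $$ (a, b) + (L * L) $$ (a, b)) / 2"
      by presburger
    moreover have "(\<lambda>k. ?Z (Suc k) $$ (a, b)) \<longlonglongrightarrow> L $$ (a, b)"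
      using LIMSEQ_Suc[OF lim[OF ab]] .
    ultimately have "L $$ (a, b) = (X $$ (a, b) + (L * L) $$ (a, b)) / 2"
      using LIMSEQ_unique by blast
    then show "L $$ (a, b) = ((1 / 2) \<cdot>\<^sub>m (X + L * L)) $$ (a, b)"
      using X L ab by simp
  qed (use X L in auto)
  ultimately show ?thesis using L by (intro bexI[of _ L]) (auto simp: pos_semidef_def)
qed

text \<open>With c bounding the form of Q, the matrix X = 1 - Q / c lies between 0 and 1, so the
  iteration yields L with (1 - L)^2 = 1 - X = Q / c. The root is S = sqrt c (1 - L), semidefinite
  because L is at most 1.\<close>

lemma psd_sqrt_exists:
  assumes Q: "Q \<in> carrier_mat n n" and psd: "pos_semidef Q"
  shows "\<exists>S\<in>carrier_mat n n. pos_semidef S \<and> S * S = Q"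
proof -
  obtain c where c: "c > 0" "\<And>x. x \<in> carrier_vec n \<Longrightarrow> x \<bullet> (Q *\<^sub>v x) \<le> c * (x \<bullet> x)"
    using form_bounded[OF Q] by blast
  define X where "X = 1\<^sub>m n - (1 / c) \<cdot>\<^sub>m Q"
  have X: "X \<in> carrier_mat n n" using Q by (simp add: X_def minus_carrier_mat)
  have form: "x \<bullet> (X *\<^sub>v x) = x \<bullet> x - x \<bullet> (Q *\<^sub>v x) / c" if "x \<in> carrier_vec n" for x
    using that Q by (simp add: X_def minus_mult_distrib_mat_vec[of _ n n]
        smult_mult_mat_vec[of _ n n] scalar_prod_minus_distrib[of _ n])
  have QT: "Q\<^sup>T = Q" and Q0: "\<And>x. x \<in> carrier_vec n \<Longrightarrow> 0 \<le> x \<bullet> (Q *\<^sub>v x)"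
    using psd Q by (auto simp: pos_semidef_def)
  have "X\<^sup>T = X" using QT Q by (auto simp: X_def transpose_minus[of _ n n] smult_transpose_mat)
  moreover have "0 \<le> x \<bullet> (X *\<^sub>v x)" if "x \<in> carrier_vec n" for x
    using form[OF that] c(2)[OF that] c(1) by (simp add: divide_le_eq mult.commute)
  ultimately have "pos_semidef X" using X by (auto simp: pos_semidef_def)
  moreover have "x \<bullet> (X *\<^sub>v x) \<le> x \<bullet> x" if "x \<in> carrier_vec n" for x
    using form[OF that] Q0[OF that] c(1) by simp
  ultimately obtain L where L: "L \<in> carrier_mat n n" "pos_semidef L"
      "\<And>x. x \<in> carrier_vec n \<Longrightarrow> x \<bullet> (L *\<^sub>v x) \<le> x \<bullet> x" "L = (1 / 2) \<cdot>\<^sub>m (X + L * L)"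
    using sqrt_iter_limit[OF X] by metis
  define S where "S = sqrt c \<cdot>\<^sub>m (1\<^sub>m n - L)"
  have IL: "1\<^sub>m n - L \<in> carrier_mat n n" using L by (simp add: minus_carrier_mat)
  have S: "S \<in> carrier_mat n n" using IL by (simp add: S_def)
  have LT: "L\<^sup>T = L" using L by (simp add: pos_semidef_def)
  have "S\<^sup>T = S" using LT L by (auto simp: S_def transpose_minus[of _ n n] smult_transpose_mat)
  moreover have "0 \<le> x \<bullet> (S *\<^sub>v x)" if "x \<in> carrier_vec n" for x
    using that L(1) L(3)[OF that] c(1) IL by (simp add: S_def minus_mult_distrib_mat_vec[of _ n n]
        smult_mult_mat_vec[of _ n n] scalar_prod_minus_distrib[of _ n])
  moreover have "S * S = Q"
  proof (rule eq_matI)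
    fix a b assume "a < dim_row Q" "b < dim_col Q"
    then have ab: "a < n" "b < n" using Q by auto
    have "S * S = c \<cdot>\<^sub>m ((1\<^sub>m n - L) * (1\<^sub>m n - L))"
      using IL c(1) by (simp add: S_def mult_smult_assoc_mat[of _ n n _ n]
          mult_smult_distrib[of _ n n _ n] smult_smult_mat)
    also have "(1\<^sub>m n - L) * (1\<^sub>m n - L) = (1\<^sub>m n - L) - (L - L * L)"
      using L(1) IL by (simp add: minus_mult_distrib_mat[of _ n n _ _ n]
          mult_minus_distrib_mat[of _ n n _ n])
    finally have "S * S = c \<cdot>\<^sub>m ((1\<^sub>m n - L) - (L - L * L))" .
    moreover have "L $$ (a, b) = (X $$ (a, b) + (L * L) $$ (a, b)) / 2"
      using arg_cong[OF L(4), of "\<lambda>M. M $$ (a, b)"] ab X L(1) by simp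
    ultimately show "(S * S) $$ (a, b) = Q $$ (a, b)"
      using ab L(1) Q c(1) by (simp add: X_def field_simps)
  qed (use S Q in auto)
  ultimately show ?thesis using S by (intro bexI[of _ S]) (auto simp: pos_semidef_def)
qed

lemma psd_sqrt:
  assumes "Q \<in> carrier_mat n n" "pos_semidef Q"
  shows "psd_sqrt Q \<in> carrier_mat n n" "(psd_sqrt Q)\<^sup>T = psd_sqrt Q" "psd_sqrt Q * psd_sqrt Q = Q"
proof -
  have "\<exists>S. S \<in> carrier_mat (dim_row Q) (dim_row Q) \<and> pos_semidef S \<and> S * S = Q"
    using psd_sqrt_exists[OF assms] assms(1) by auto
  from someI_ex[OF this] show "psd_sqrt Q \<in> carrier_mat n n" "(psd_sqrt Q)\<^sup>T = psd_sqrt Q"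
      "psd_sqrt Q * psd_sqrt Q = Q"
    using assms(1) unfolding psd_sqrt_def[symmetric] by (auto simp: pos_semidef_def)
qed

section \<open>Positive definite matrices\<close>

text \<open>A singular P would have a nonzero kernel vector, at which its form vanishes. Only after
  this does \<open>the\<close> in \<open>mat_inv\<close> denote an actual inverse.\<close>

lemma mat_inv_pos_def:
  assumes P: "P \<in> carrier_mat n n" and pd: "pos_def P"
  shows "mat_inv P \<in> carrier_mat n n" "P * mat_inv P = 1\<^sub>m n" "mat_inv P * P = 1\<^sub>m n"
proof -
  have "det P \<noteq> 0"
  proof
    assume "det P = 0"
    then obtain v where v: "v \<in> carrier_vec n" "v \<noteq> 0\<^sub>v n" "P *\<^sub>v v = 0\<^sub>v n"
      using det_0_iff_vec_prod_zero_field[OF P] by blast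
    then have "v \<bullet> (P *\<^sub>v v) = 0" by simp
    then show False using v(1,2) pd P unfolding pos_def_def by force
  qed
  then have "P \<in> Units (ring_mat TYPE(real) n ())" using det_non_zero_imp_unit[OF P] by simp
  then obtain E where E: "mat_inverse P = Some E"
    using mat_inverse(1)[OF P, where b = "()"] by (cases "mat_inverse P") auto
  show "mat_inv P \<in> carrier_mat n n" "P * mat_inv P = 1\<^sub>m n" "mat_inv P * P = 1\<^sub>m n"
    using mat_inverse(2)[OF P E] E unfolding mat_inv_def by auto
qed

lemma mat_inv_mult_vec:
  assumes P: "P \<in> carrier_mat n n" "pos_def P" and x: "x \<in> carrier_vec n"
  shows "P *\<^sub>v (mat_inv P *\<^sub>v x) = x" "mat_inv P *\<^sub>v (P *\<^sub>v x) = x"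
  using mat_inv_pos_def[OF P] P(1) x assoc_mult_mat_vec[of P n n "mat_inv P" n x]
    assoc_mult_mat_vec[of "mat_inv P" n n P n x]
  by (metis one_mult_mat_vec)+

lemma mat_inv_symmetric:
  assumes P: "P \<in> carrier_mat n n" "pos_def P"
  shows "(mat_inv P)\<^sup>T = mat_inv P"
proof -
  note i = mat_inv_pos_def[OF P]
  have T: "P\<^sup>T = P" using P by (simp add: pos_def_def)
  have "(mat_inv P)\<^sup>T * P = 1\<^sub>m n" using i(2) transpose_mult[OF P(1) i(1)] T by simp
  then have "((mat_inv P)\<^sup>T * P) * mat_inv P = mat_inv P" using i by simp
  then show ?thesis using i P by (simp add: assoc_mult_mat[of _ n n _ n _ n])
qed

lemma pos_def_mat_inv:
  assumes P: "P \<in> carrier_mat n n" "pos_def P"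
  shows "pos_def (mat_inv P)"
proof -
  note i = mat_inv_pos_def[OF P]
  have "0 < x \<bullet> (mat_inv P *\<^sub>v x)" if x: "x \<in> carrier_vec n" "x \<noteq> 0\<^sub>v n" for x
  proof -
    let ?y = "mat_inv P *\<^sub>v x"
    have y: "?y \<in> carrier_vec n" using i x by simp
    have Py: "P *\<^sub>v ?y = x" using mat_inv_mult_vec[OF P x(1)] by simp
    then have "?y \<noteq> 0\<^sub>v n" using x(2) mult_mat_zero_vec[OF P(1)] by auto
    then have "0 < ?y \<bullet> (P *\<^sub>v ?y)" using P y unfolding pos_def_def by auto
    then show ?thesis using Py comm_scalar_prod[OF x(1) y] by simp
  qed
  then show ?thesis using i(1) mat_inv_symmetric[OF P] by (auto simp: pos_def_def)
qed

text \<open>Writing \<open>x \<bullet> x = x \<bullet> D (D\<^sup>-\<^sup>1 x)\<close> and applying the Cauchy--Schwarz inequality of \<open>D\<close>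
  avoids a compactness argument.\<close>

lemma pos_def_bounded_below:
  assumes D: "D \<in> carrier_mat n n" "pos_def D"
  shows "\<exists>\<epsilon>>0. \<forall>x\<in>carrier_vec n. \<epsilon> * (x \<bullet> x) \<le> x \<bullet> (D *\<^sub>v x)"
proof -
  note i = mat_inv_pos_def[OF D]
  obtain c where c: "c > 0" "\<And>x. x \<in> carrier_vec n \<Longrightarrow> x \<bullet> (mat_inv D *\<^sub>v x) \<le> c * (x \<bullet> x)"
    using form_bounded[OF i(1)] by blast
  have "(1 / c) * (x \<bullet> x) \<le> x \<bullet> (D *\<^sub>v x)" if x: "x \<in> carrier_vec n" for x
  proof (cases "x \<bullet> x = 0")
    case True
    then show ?thesis using pos_def_imp_semidef[OF D] x D by (auto simp: pos_semidef_def)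
  next
    case False
    then have pos: "x \<bullet> x > 0" using scalar_prod_self(1)[of x] by simp
    let ?y = "mat_inv D *\<^sub>v x"
    have y: "?y \<in> carrier_vec n" using i x by simp
    have Dy: "D *\<^sub>v ?y = x" using mat_inv_mult_vec[OF D x] by simp
    have xD: "0 \<le> x \<bullet> (D *\<^sub>v x)"
      using pos_def_imp_semidef[OF D] x D by (auto simp: pos_semidef_def)
    have "(x \<bullet> x)\<^sup>2 \<le> (x \<bullet> (D *\<^sub>v x)) * (?y \<bullet> x)"
      using form_Cauchy_Schwarz[OF D(1) pos_def_imp_semidef[OF D] x y] Dy by simp
    also have "\<dots> \<le> (x \<bullet> (D *\<^sub>v x)) * (c * (x \<bullet> x))"
      using c(2)[OF x] comm_scalar_prod[OF x y] xD by (intro mult_left_mono) auto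
    finally have "x \<bullet> x \<le> (x \<bullet> (D *\<^sub>v x)) * c" using pos by (simp add: power2_eq_square)
    then show ?thesis using c(1) by (simp add: divide_le_eq mult.commute)
  qed
  then show ?thesis using c(1) by (intro exI[of _ "1 / c"]) auto
qed

section \<open>Scalar bounds on a matrix and on its inverse\<close>

lemma form_minus_smult_one:
  fixes Y :: "real mat"
  assumes "Y \<in> carrier_mat n n" "x \<in> carrier_vec n"
  shows "x \<bullet> ((Y - t \<cdot>\<^sub>m 1\<^sub>m n) *\<^sub>v x) = x \<bullet> (Y *\<^sub>v x) - t * (x \<bullet> x)"
  using assms by (simp add: minus_mult_distrib_mat_vec[of _ n n] smult_mult_mat_vec[of _ n n]
      scalar_prod_minus_distrib[of _ n])

lemma pos_def_minus_smult_one_iff: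
  assumes "Y \<in> carrier_mat n n" "Y\<^sup>T = Y"
  shows "pos_def (Y - t \<cdot>\<^sub>m 1\<^sub>m n)
    \<longleftrightarrow> (\<forall>x\<in>carrier_vec n. x \<noteq> 0\<^sub>v n \<longrightarrow> t * (x \<bullet> x) < x \<bullet> (Y *\<^sub>v x))"
  using assms form_minus_smult_one[OF assms(1)]
  by (auto simp: pos_def_def transpose_minus[of _ n n] smult_transpose_mat minus_carrier_mat)

text \<open>Turns the condition on Y = P^-1 in \<open>Y_set\<close> into an upper bound on P, which
  is what a cost bound speaks about. Order reversal under inversion is obtained from two
  Cauchy-Schwarz inequalities, one for the standard inner product and one for the form of P.\<close>

lemma pos_def_minus_smult_one_iff_inv:
  assumes P: "P \<in> carrier_mat n n" "pos_def P" and t: "t > 0"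
  shows "pos_def (mat_inv P - t \<cdot>\<^sub>m 1\<^sub>m n)
    \<longleftrightarrow> (\<forall>x\<in>carrier_vec n. x \<noteq> 0\<^sub>v n \<longrightarrow> t * (x \<bullet> (P *\<^sub>v x)) < x \<bullet> x)"
proof -
  define Y where "Y = mat_inv P"
  have Y: "Y \<in> carrier_mat n n" "pos_def Y" "Y\<^sup>T = Y"
    using mat_inv_pos_def[OF P] pos_def_mat_inv[OF P] mat_inv_symmetric[OF P] by (auto simp: Y_def)
  have nz: "M *\<^sub>v x \<in> carrier_vec n \<and> M *\<^sub>v x \<noteq> 0\<^sub>v n \<and> 0 < x \<bullet> (M *\<^sub>v x)"
    if "M \<in> carrier_mat n n" "pos_def M" "x \<in> carrier_vec n" "x \<noteq> 0\<^sub>v n" for M x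
  proof -
    have pos: "0 < x \<bullet> (M *\<^sub>v x)" using that unfolding pos_def_def by auto
    have "M *\<^sub>v x \<noteq> 0\<^sub>v n"
    proof
      assume "M *\<^sub>v x = 0\<^sub>v n"
      then show False using pos that(3) by simp
    qed
    then show ?thesis using pos mult_mat_vec_carrier[OF that(1,3)] by simp
  qed
  \<comment> \<open>Here M inverts L. For x = L y the form of M at x is y . x, hence t (y . x)^2 <=
    (y . y) t (x . x) < (y . y) (y . x), and the positive factor y . x cancels.\<close>
  have main: "t * (y \<bullet> (L *\<^sub>v y)) < y \<bullet> y" 
    if t: "t > 0" and M: "M \<in> carrier_mat n n" "pos_def M" and L: "L \<in> carrier_mat n n" "pos_def L"
    and LM: "\<And>x. x \<in> carrier_vec n \<Longrightarrow> M *\<^sub>v (L *\<^sub>v x) = x"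
    and lt: "\<And>x. x \<in> carrier_vec n \<Longrightarrow> x \<noteq> 0\<^sub>v n \<Longrightarrow> t * (x \<bullet> x) < x \<bullet> (M *\<^sub>v x)"
    and y: "y \<in> carrier_vec n" "y \<noteq> 0\<^sub>v n" for t M L y
  proof -
    let ?x = "L *\<^sub>v y"
    have x: "?x \<in> carrier_vec n" "?x \<noteq> 0\<^sub>v n" "0 < y \<bullet> ?x" using nz[OF L y] by auto
    have "t * (?x \<bullet> ?x) < y \<bullet> ?x"
      using lt[OF x(1,2)] LM[OF y(1)] comm_scalar_prod[OF y(1) x(1)] by simp
    have "(t * (y \<bullet> ?x)) * (y \<bullet> ?x) = t * (y \<bullet> ?x)\<^sup>2" by (simp add: power2_eq_square)
    also have "\<dots> \<le> t * ((y \<bullet> y) * (?x \<bullet> ?x))"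
      using Cauchy_Schwarz_vec[OF y(1) x(1)] t by (intro mult_left_mono) auto
    also have "\<dots> = (y \<bullet> y) * (t * (?x \<bullet> ?x))" by simp
    also have "\<dots> < (y \<bullet> y) * (y \<bullet> ?x)"
      using \<open>t * (?x \<bullet> ?x) < y \<bullet> ?x\<close> scalar_prod_self_pos[OF y] by (intro mult_strict_left_mono)
    finally show ?thesis using x(3) by simp
  qed
  have PY: "\<And>x. x \<in> carrier_vec n \<Longrightarrow> P *\<^sub>v (Y *\<^sub>v x) = x"
    and YP: "\<And>x. x \<in> carrier_vec n \<Longrightarrow> Y *\<^sub>v (P *\<^sub>v x) = x"
    using mat_inv_mult_vec[OF P] by (auto simp: Y_def)
  have "(\<forall>x\<in>carrier_vec n. x \<noteq> 0\<^sub>v n \<longrightarrow> t * (x \<bullet> x) < x \<bullet> (Y *\<^sub>v x))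
    \<longleftrightarrow> (\<forall>x\<in>carrier_vec n. x \<noteq> 0\<^sub>v n \<longrightarrow> t * (x \<bullet> (P *\<^sub>v x)) < x \<bullet> x)" (is "?a \<longleftrightarrow> ?b")
  proof
    assume ?a
    then show ?b using main[OF t Y(1,2) P YP] by blast
  next
    assume b: ?b
    show ?a
    proof (intro ballI impI)
      fix x :: "real vec" assume x: "x \<in> carrier_vec n" "x \<noteq> 0\<^sub>v n"
      let ?y = "Y *\<^sub>v x"
      have y: "?y \<in> carrier_vec n" "?y \<noteq> 0\<^sub>v n" "0 < x \<bullet> ?y" using nz[OF Y(1,2) x] by auto
      have pos: "0 < x \<bullet> x" using scalar_prod_self_pos[OF x] .
      \<comment> \<open>Cauchy-Schwarz in the form of P for x and y = Y x: since P y = x, the mixed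
        term is x . x and the form at y is y . x.\<close>
      have "(x \<bullet> x)\<^sup>2 \<le> (x \<bullet> (P *\<^sub>v x)) * (?y \<bullet> x)"
        using form_Cauchy_Schwarz[OF P(1) pos_def_imp_semidef[OF P] x(1) y(1)] PY[OF x(1)] by simp
      then have "t * (x \<bullet> x)\<^sup>2 \<le> t * ((x \<bullet> (P *\<^sub>v x)) * (?y \<bullet> x))"
        using t by (intro mult_left_mono) auto
      also have "\<dots> = (t * (x \<bullet> (P *\<^sub>v x))) * (x \<bullet> ?y)"
        using comm_scalar_prod[OF x(1) y(1)] by simp
      also have "\<dots> < (x \<bullet> x) * (x \<bullet> ?y)"
        using b x y(3) by (intro mult_strict_right_mono) auto
      finally have "(x \<bullet> x) * (t * (x \<bullet> x)) < (x \<bullet> x) * (x \<bullet> ?y)"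
        by (simp add: power2_eq_square mult_ac)
      then show "t * (x \<bullet> x) < x \<bullet> ?y" using pos by simp
    qed
  qed
  then show ?thesis using pos_def_minus_smult_one_iff[OF Y(1,3)] by (simp add: Y_def)
qed

section \<open>Lyapunov equations\<close>

lemma pow_mat_smult:
  fixes X :: "'a :: comm_semiring_1 mat"
  assumes "X \<in> carrier_mat n n"
  shows "(c \<cdot>\<^sub>m X) ^\<^sub>m k = c ^ k \<cdot>\<^sub>m (X ^\<^sub>m k)"
proof (induction k)
  case 0
  show ?case using assms by (intro eq_matI) auto
next
  case (Suc k)
  have "(c ^ k \<cdot>\<^sub>m (X ^\<^sub>m k)) * (c \<cdot>\<^sub>m X) = (c ^ k * c) \<cdot>\<^sub>m (X ^\<^sub>m k * X)"
    using assms by (intro eq_matI) (auto simp: smult_scalar_prod_distrib[of _ n]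
        scalar_prod_smult_distrib[of _ n] mult_ac)
  then show ?case using Suc by (simp add: mult.commute)
qed

text \<open>Spectral radius below 1 gives bounded powers. Applied to M / \<open>\<theta>\<close>,
  with \<open>\<theta>\<close> strictly between the spectral radius of M and 1, boundedness becomes
  geometric decay of the powers of M.\<close>

lemma schur_stable_power_decay:
  assumes M: "M \<in> carrier_mat n n" and stable: "schur_stable M"
  shows "\<exists>c \<theta>. 0 \<le> \<theta> \<and> \<theta> < 1 \<and> (\<forall>k. norm_bound (M ^\<^sub>m k) (c * \<theta> ^ k))"
proof (cases "n = 0")
  \<comment> \<open>In dimension 0 the spectrum is empty, so the spectral radius, a maximum over it,
    carries no information.\<close>
  case True
  then have "norm_bound (M ^\<^sub>m k) (0 * 0 ^ k)" for k
    using M pow_carrier_mat[OF M, of k] by (auto simp: norm_bound_def)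
  then show ?thesis by (intro exI[of _ 0]) auto
next
  case False
  let ?C = "map_mat complex_of_real M"
  have C: "?C \<in> carrier_mat n n" using M by simp
  define \<rho> where "\<rho> = spectral_radius ?C"
  \<comment> \<open>The midpoint is positive even for a nilpotent M, so dividing by it is
    safe.\<close>
  define \<theta> where "\<theta> = (1 + \<rho>) / 2"
  have "\<rho> \<in> cmod ` spectrum ?C" unfolding \<rho>_def using spectral_radius_mem_max(1)[OF C] False by simp
  then have "0 \<le> \<rho>" "\<rho> < 1" using stable by (auto simp: schur_stable_def)
  then have \<theta>: "0 < \<theta>" "\<theta> < 1" "\<rho> < \<theta>" by (auto simp: \<theta>_def)
  define D where "D = complex_of_real (1 / \<theta>) \<cdot>\<^sub>m ?C"
  have D: "D \<in> carrier_mat n n" using C by (simp add: D_def)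
  have "spectral_radius D \<in> cmod ` spectrum D" using spectral_radius_mem_max(1)[OF D] False by simp
  then obtain z v where z: "spectral_radius D = cmod z"
      "v \<in> carrier_vec n" "v \<noteq> 0\<^sub>v n" "D *\<^sub>v v = z \<cdot>\<^sub>v v"
    using D by (auto simp: spectrum_def eigenvalue_def eigenvector_def)
  \<comment> \<open>An eigenvalue z of the scaled matrix yields the eigenvalue
    \<open>\<theta>\<close> z of the original one, whence \<open>\<theta>\<close> |z| is at most
    \<open>\<rho>\<close>, which is less than \<open>\<theta>\<close>.\<close>
  have "?C *\<^sub>v v = (complex_of_real \<theta> * z) \<cdot>\<^sub>v v"
  proof -
    have "complex_of_real \<theta> \<cdot>\<^sub>v (D *\<^sub>v v) = ?C *\<^sub>v v"
      unfolding D_def smult_mult_mat_vec[OF C z(2)] using \<theta>(1)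
      by (simp add: smult_smult_assoc flip: of_real_mult)
    then show ?thesis unfolding z(4) by (simp add: smult_smult_assoc)
  qed
  then have "complex_of_real \<theta> * z \<in> spectrum ?C"
    using z(2,3) C by (auto simp: spectrum_def eigenvalue_def eigenvector_def)
  then have "cmod (complex_of_real \<theta> * z) \<le> \<rho>"
    unfolding \<rho>_def using spectral_radius_mem_max(2)[OF C] False by simp
  then have "\<theta> * cmod z \<le> \<rho>" using \<theta>(1) by (simp add: norm_mult)
  then have "\<theta> * cmod z < \<theta> * 1" using \<theta>(3) by linarith
  then have "spectral_radius D < 1" using \<theta>(1) z(1) by (simp only: mult_less_cancel_left_pos)
  then obtain c where c: "\<And>k. norm_bound (D ^\<^sub>m k) c"
    using spectral_radius_jnf_norm_bound_less_1_upper_triangular[OF D] by blast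
  have "norm_bound (M ^\<^sub>m k) (c * \<theta> ^ k)" for k
    unfolding norm_bound_def
  proof (intro allI impI)
    fix a b assume "a < dim_row (M ^\<^sub>m k)" "b < dim_col (M ^\<^sub>m k)"
    then have ab: "a < n" "b < n" using pow_carrier_mat[OF M, of k] by auto
    have "?C ^\<^sub>m k = map_mat complex_of_real (M ^\<^sub>m k)"
      by (rule of_real_hom.mat_hom_pow[OF M, symmetric])
    then have "D ^\<^sub>m k = complex_of_real (1 / \<theta>) ^ k \<cdot>\<^sub>m map_mat complex_of_real (M ^\<^sub>m k)"
      unfolding D_def using pow_mat_smult[OF C] by simp
    then have "(D ^\<^sub>m k) $$ (a, b) = complex_of_real ((1 / \<theta>) ^ k * (M ^\<^sub>m k) $$ (a, b))"
      using ab carrier_matD[OF pow_carrier_mat[OF M, of k]] by simp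
    moreover have "cmod ((D ^\<^sub>m k) $$ (a, b)) \<le> c"
      using c[of k] ab unfolding norm_bound_def carrier_matD[OF pow_carrier_mat[OF D]] by blast
    ultimately have "\<bar>(1 / \<theta>) ^ k * (M ^\<^sub>m k) $$ (a, b)\<bar> \<le> c" by (metis norm_of_real)
    then show "norm ((M ^\<^sub>m k) $$ (a, b)) \<le> c * \<theta> ^ k"
      using \<theta>(1) by (simp add: abs_mult power_divide divide_le_eq)
  qed
  then show ?thesis using \<theta> by (intro exI[of _ c] exI[of _ \<theta>]) auto
qed

section \<open>Costs along trajectories as quadratic forms\<close>

lemma trajectory_eq_power:
  assumes "M \<in> carrier_mat n n" "x \<in> carrier_vec n"
  shows "trajectory M x k = M ^\<^sub>m k *\<^sub>v x"
proof (induction k)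
  case 0
  show ?case using assms by simp
next
  case (Suc k)
  have "trajectory M x (Suc k) = M *\<^sub>v (M ^\<^sub>m k *\<^sub>v x)" using Suc by simp
  also have "\<dots> = (M * M ^\<^sub>m k) *\<^sub>v x"
    using assoc_mult_mat_vec[OF assms(1) pow_carrier_mat[OF assms(1)] assms(2)] by simp
  finally show ?case using pow_mat_Suc_left[OF assms(1)] by simp
qed

lemma trajectory_carrier:
  "M \<in> carrier_mat n n \<Longrightarrow> x \<in> carrier_vec n \<Longrightarrow> trajectory M x k \<in> carrier_vec n"
  by (induction k) auto

lemma trajectory_shift: "trajectory M (M *\<^sub>v x) k = trajectory M x (Suc k)"
  by (induction k) auto

text \<open>P is the series of the matrices (M^k)^T W M^k, summed entry by entry; geometric decay
  makes each entry absolutely summable. Allowing any symmetric W serves both the stage cost and the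
  identity weight.\<close>

lemma lyapunov_solution:
  assumes M: "M \<in> carrier_mat n n" and stable: "schur_stable M"
    and W: "W \<in> carrier_mat n n" "W\<^sup>T = W"
  shows "\<exists>P\<in>carrier_mat n n. P\<^sup>T = P \<and> (\<forall>x\<in>carrier_vec n.
    (\<lambda>k. trajectory M x k \<bullet> (W *\<^sub>v trajectory M x k)) sums (x \<bullet> (P *\<^sub>v x)))"
proof -
  obtain c \<theta> where \<theta>: "0 \<le> \<theta>" "\<theta> < 1" and c: "\<And>k. norm_bound (M ^\<^sub>m k) (c * \<theta> ^ k)"
    using schur_stable_power_decay[OF M stable] by blast
  obtain w where w: "norm_bound W w" using norm_bound_max by blast
  define T where "T k = (M ^\<^sub>m k)\<^sup>T * (W * M ^\<^sub>m k)" for k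
  have Mk: "M ^\<^sub>m k \<in> carrier_mat n n" for k using M by simp
  have WM: "W * M ^\<^sub>m k \<in> carrier_mat n n" for k using W(1) Mk by (rule mult_carrier_mat)
  have MT: "(M ^\<^sub>m k)\<^sup>T \<in> carrier_mat n n" for k using Mk by simp
  have T: "T k \<in> carrier_mat n n" for k unfolding T_def using MT WM by (rule mult_carrier_mat)
  \<comment> \<open>The constant produced by bounding the entries of a triple product: entry bounds
    c, w, c and one factor n for each of the two multiplications.\<close>
  define q where "q = c * (w * c * n) * n"
  have bound: "norm (T k $$ (a, b)) \<le> q * (\<theta>\<^sup>2) ^ k" if "a < n" "b < n" for a b k
  proof -
    have "norm_bound ((M ^\<^sub>m k)\<^sup>T) (c * \<theta> ^ k)"
      using c[of k] Mk[of k] by (auto simp: norm_bound_def)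
    then have "norm_bound (T k) (c * \<theta> ^ k * (w * (c * \<theta> ^ k) * of_nat n) * of_nat n)"
      unfolding T_def by (intro norm_bound_mult[OF MT WM] norm_bound_mult[OF W(1) Mk] w c)
    then show ?thesis
      using that T[of k] by (auto simp: norm_bound_def q_def power_mult_distrib mult_ac
          power2_eq_square)
  qed
  have summ: "summable (\<lambda>k. T k $$ (a, b))" if "a < n" "b < n" for a b
  proof (rule summable_comparison_test')
    have "\<theta>\<^sup>2 < 1" using \<theta> by (simp add: power2_eq_square mult_le_one order_le_less_trans[OF mult_left_le])
    then show "summable (\<lambda>k. q * (\<theta>\<^sup>2) ^ k)"
      using \<theta> by (intro summable_mult summable_geometric) simp
    show "norm (T k $$ (a, b)) \<le> q * (\<theta>\<^sup>2) ^ k" for k using bound[OF that] .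
  qed
  define P where "P = mat n n (\<lambda>ab. \<Sum>k. T k $$ ab)"
  have P: "P \<in> carrier_mat n n" by (simp add: P_def)
  have sums: "(\<lambda>k. T k $$ (a, b)) sums (P $$ (a, b))" if "a < n" "b < n" for a b
    using summ[OF that] that by (simp add: P_def summable_sums)
  have "P\<^sup>T = P"
  proof (rule symmetric_eqI[OF P])
    fix a b assume ab: "a < n" "b < n"
    have "(T k)\<^sup>T = T k" for k
    proof -
      have "(T k)\<^sup>T = (W * M ^\<^sub>m k)\<^sup>T * M ^\<^sub>m k"
        unfolding T_def using transpose_mult[OF MT WM, of k k] by simp
      also have "\<dots> = ((M ^\<^sub>m k)\<^sup>T * W) * M ^\<^sub>m k"
        using transpose_mult[OF W(1) Mk, of k] W(2) by simp
      finally show ?thesis unfolding T_def using assoc_mult_mat[OF MT W(1) Mk] by simp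
    qed
    then have "T k $$ (a, b) = T k $$ (b, a)" for k
      using ab T[of k] index_transpose_mat(1)[of b "T k" a] by auto
    then show "P $$ (a, b) = P $$ (b, a)" using ab by (simp add: P_def)
  qed
  moreover have "(\<lambda>k. trajectory M x k \<bullet> (W *\<^sub>v trajectory M x k)) sums (x \<bullet> (P *\<^sub>v x))"
    if x: "x \<in> carrier_vec n" for x
  proof -
    have "(\<lambda>k. \<Sum>a<n. \<Sum>b<n. x $ a * T k $$ (a, b) * x $ b)
        sums (\<Sum>a<n. \<Sum>b<n. x $ a * P $$ (a, b) * x $ b)"
      by (intro sums_sum sums_mult sums_mult2 sums) auto
    then have "(\<lambda>k. x \<bullet> (T k *\<^sub>v x)) sums (x \<bullet> (P *\<^sub>v x))"
      using form_sum[OF T x x] form_sum[OF P x x] by simp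
    moreover have "x \<bullet> (T k *\<^sub>v x) = trajectory M x k \<bullet> (W *\<^sub>v trajectory M x k)" for k
    proof -
      let ?y = "M ^\<^sub>m k *\<^sub>v x"
      have y: "?y \<in> carrier_vec n" using mult_mat_vec_carrier[OF Mk x] .
      have Wy: "W *\<^sub>v ?y \<in> carrier_vec n" using mult_mat_vec_carrier[OF W(1) y] .
      have "T k *\<^sub>v x = (M ^\<^sub>m k)\<^sup>T *\<^sub>v (W *\<^sub>v ?y)"
        unfolding T_def assoc_mult_mat_vec[OF MT WM x] assoc_mult_mat_vec[OF W(1) Mk x] ..
      then have "x \<bullet> (T k *\<^sub>v x) = (W *\<^sub>v ?y) \<bullet> ?y"
        using form_transpose[OF MT x Wy] by simp
      then show ?thesis using comm_scalar_prod[OF Wy y] trajectory_eq_power[OF M x] by simp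
    qed
    ultimately show ?thesis by simp
  qed
  ultimately show ?thesis using P by blast
qed

text \<open>Splitting off the stage k = 0 leaves the cost series of the trajectory that starts at M
  x.\<close>

lemma lyapunov_equation:
  assumes M: "M \<in> carrier_mat n n" and x: "x \<in> carrier_vec n"
    and sums: "\<And>x. x \<in> carrier_vec n \<Longrightarrow>
      (\<lambda>k. trajectory M x k \<bullet> (W *\<^sub>v trajectory M x k)) sums (x \<bullet> (P *\<^sub>v x))"
  shows "x \<bullet> (P *\<^sub>v x) = (M *\<^sub>v x) \<bullet> (P *\<^sub>v (M *\<^sub>v x)) + x \<bullet> (W *\<^sub>v x)"
proof -
  have "(\<lambda>k. trajectory M x (Suc k) \<bullet> (W *\<^sub>v trajectory M x (Suc k)))
      sums ((M *\<^sub>v x) \<bullet> (P *\<^sub>v (M *\<^sub>v x)))"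
    using sums[of "M *\<^sub>v x"] M x unfolding trajectory_shift by auto
  then have "(\<lambda>k. trajectory M x k \<bullet> (W *\<^sub>v trajectory M x k))
      sums ((M *\<^sub>v x) \<bullet> (P *\<^sub>v (M *\<^sub>v x)) + x \<bullet> (W *\<^sub>v x))"
    by (subst (asm) sums_Suc_iff) simp
  then show ?thesis using sums[OF x] sums_unique2 by blast
qed

text \<open>A complex eigenvector is split as v = a + i b to stay with the real form q of P. On a
  and b the matrix M acts as a rotation scaled by |z|, so q(M a) + q(M b) = |z|^2 (q(a) + q(b));
  strict decrease on whichever of a, b is nonzero forces |z| < 1.\<close>

lemma lyapunov_imp_schur_stable:
  assumes M: "M \<in> carrier_mat n n" and P: "P \<in> carrier_mat n n" "pos_def P"
    and dec: "\<And>x. x \<in> carrier_vec n \<Longrightarrow> x \<noteq> 0\<^sub>v n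
      \<Longrightarrow> (M *\<^sub>v x) \<bullet> (P *\<^sub>v (M *\<^sub>v x)) < x \<bullet> (P *\<^sub>v x)"
  shows "schur_stable M"
  unfolding schur_stable_def
proof
  let ?C = "map_mat complex_of_real M"
  fix z assume "z \<in> spectrum ?C"
  then obtain v where v: "v \<in> carrier_vec n" "v \<noteq> 0\<^sub>v n" "?C *\<^sub>v v = z \<cdot>\<^sub>v v"
    using M by (auto simp: spectrum_def eigenvalue_def eigenvector_def)
  define a where "a = map_vec Re v"
  define b where "b = map_vec Im v"
  have ab: "a \<in> carrier_vec n" "b \<in> carrier_vec n" using v by (auto simp: a_def b_def)
  have nz: "a \<noteq> 0\<^sub>v n \<or> b \<noteq> 0\<^sub>v n"
  proof (rule ccontr)
    assume "\<not> ?thesis"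
    then have *: "a = 0\<^sub>v n" "b = 0\<^sub>v n" by auto
    have "v = 0\<^sub>v n"
    proof (rule eq_vecI)
      fix i assume "i < dim_vec (0\<^sub>v n :: complex vec)"
      then have "i < n" by simp
      then have "Re (v $ i) = 0" "Im (v $ i) = 0"
        using arg_cong[OF *(1), of "\<lambda>u. u $ i"] arg_cong[OF *(2), of "\<lambda>u. u $ i"] v(1)
        by (auto simp: a_def b_def)
      then show "v $ i = 0\<^sub>v n $ i" using \<open>i < n\<close> by (simp add: complex_eq_iff)
    qed (use v in simp)
    then show False using v by simp
  qed
  have entry: "(\<Sum>j<n. complex_of_real (M $$ (i, j)) * v $ j) = z * v $ i" if "i < n" for i
    using arg_cong[OF v(3), of "\<lambda>u. u $ i"] that M v(1)
    by (simp add: scalar_prod_def row_def atLeast0LessThan)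
  have Ma: "M *\<^sub>v a = Re z \<cdot>\<^sub>v a + (- Im z) \<cdot>\<^sub>v b"
  proof (rule eq_vecI)
    fix i assume "i < dim_vec (Re z \<cdot>\<^sub>v a + (- Im z) \<cdot>\<^sub>v b)"
    then have "i < n" using ab by simp
    then show "(M *\<^sub>v a) $ i = (Re z \<cdot>\<^sub>v a + (- Im z) \<cdot>\<^sub>v b) $ i"
      using arg_cong[OF entry, of i Re] M v(1) ab
      by (simp add: scalar_prod_def row_def atLeast0LessThan a_def b_def)
  qed (use M ab in auto)
  have Mb: "M *\<^sub>v b = Im z \<cdot>\<^sub>v a + Re z \<cdot>\<^sub>v b"
  proof (rule eq_vecI)
    fix i assume "i < dim_vec (Im z \<cdot>\<^sub>v a + Re z \<cdot>\<^sub>v b)"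
    then have "i < n" using ab by simp
    then show "(M *\<^sub>v b) $ i = (Im z \<cdot>\<^sub>v a + Re z \<cdot>\<^sub>v b) $ i"
      using arg_cong[OF entry, of i Im] M v(1) ab
      by (simp add: scalar_prod_def row_def atLeast0LessThan a_def b_def add.commute)
  qed (use M ab in auto)
  let ?q = "\<lambda>x. x \<bullet> (P *\<^sub>v x)"
  have T: "P\<^sup>T = P" and q0: "\<And>x. x \<in> carrier_vec n \<Longrightarrow> 0 \<le> ?q x"
    using pos_def_imp_semidef[OF P] P by (auto simp: pos_semidef_def)
  have comb: "?q (s \<cdot>\<^sub>v a + t \<cdot>\<^sub>v b) = s\<^sup>2 * ?q a + 2 * (t * s) * (a \<bullet> (P *\<^sub>v b)) + t\<^sup>2 * ?q b" for s t
    using form_add_scaled[OF P(1) T, of "s \<cdot>\<^sub>v a" b t] ab mult_mat_vec[OF P(1) ab(1)]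
      mult_mat_vec_carrier[OF P(1) ab(1)] mult_mat_vec_carrier[OF P(1) ab(2)]
    by (simp add: power2_eq_square mult_ac)
  \<comment> \<open>The mixed terms in a . P b have coefficients -2 Re z Im z and 2 Re z Im z and
    cancel.\<close>
  have "?q (M *\<^sub>v a) + ?q (M *\<^sub>v b) = (cmod z)\<^sup>2 * (?q a + ?q b)"
    unfolding Ma Mb comb cmod_power2 by (simp add: algebra_simps)
  moreover have lt: "?q (M *\<^sub>v x) \<le> ?q x" "x \<noteq> 0\<^sub>v n \<Longrightarrow> ?q (M *\<^sub>v x) < ?q x"
    if "x \<in> carrier_vec n" for x
    using dec[OF that] mult_mat_zero_vec[OF M] by (cases "x = 0\<^sub>v n"; force)+
  ultimately have "(cmod z)\<^sup>2 * (?q a + ?q b) < ?q a + ?q b"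
    using nz lt[OF ab(1)] lt[OF ab(2)] by linarith
  moreover have "?q a + ?q b \<ge> 0" using q0 ab by simp
  ultimately have "(cmod z)\<^sup>2 < 1"
    by (metis mult_1 mult_right_mono not_less)
  then show "z \<in> {z. cmod z < 1}" by (simp add: power_less_one_iff)
qed

text \<open>The decrease telescopes: the cost of the first l stages is at most the form of P at the
  initial state minus that at the state reached, which is nonnegative.\<close>

lemma trajectory_cost_le:
  assumes M: "M \<in> carrier_mat n n" and P: "P \<in> carrier_mat n n" "pos_semidef P"
    and W: "W \<in> carrier_mat n n" "pos_semidef W" and x: "x \<in> carrier_vec n"
    and dec: "\<And>x. x \<in> carrier_vec n
      \<Longrightarrow> (M *\<^sub>v x) \<bullet> (P *\<^sub>v (M *\<^sub>v x)) + x \<bullet> (W *\<^sub>v x) \<le> x \<bullet> (P *\<^sub>v x)"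
  shows "(\<Sum>k. ereal (trajectory M x k \<bullet> (W *\<^sub>v trajectory M x k))) \<le> ereal (x \<bullet> (P *\<^sub>v x))"
proof (rule suminf_bound[OF allI])
  fix l
  let ?x = "trajectory M x"
  note c = trajectory_carrier[OF M x]
  show "0 \<le> ereal (?x l \<bullet> (W *\<^sub>v ?x l))" using W c by (auto simp: pos_semidef_def)
  have "(\<Sum>k<l. ?x k \<bullet> (W *\<^sub>v ?x k)) \<le> x \<bullet> (P *\<^sub>v x) - ?x l \<bullet> (P *\<^sub>v ?x l)"
  proof (induction l)
    case (Suc l)
    then show ?case using dec[OF c, of l] by simp
  qed simp
  moreover have "0 \<le> ?x l \<bullet> (P *\<^sub>v ?x l)" using P c by (auto simp: pos_semidef_def)
  ultimately show "(\<Sum>k<l. ereal (?x k \<bullet> (W *\<^sub>v ?x k))) \<le> ereal (x \<bullet> (P *\<^sub>v x))" by simp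
qed

section \<open>Block matrices\<close>

lemma append_zero_vec_iff:
  assumes "a \<in> carrier_vec n" "b \<in> carrier_vec k"
  shows "a @\<^sub>v b = 0\<^sub>v (n + k) \<longleftrightarrow> a = 0\<^sub>v n \<and> b = 0\<^sub>v k"
proof -
  have "0\<^sub>v n @\<^sub>v 0\<^sub>v k = 0\<^sub>v (n + k)" by (intro eq_vecI) auto
  then show ?thesis using append_vec_eq[OF assms(1) zero_carrier_vec, of b "0\<^sub>v k"] by metis
qed

lemma append_vec_four_zero_iff:
  assumes "a \<in> carrier_vec n1" "b \<in> carrier_vec n2" "c \<in> carrier_vec n3" "d \<in> carrier_vec n4"
  shows "(a @\<^sub>v b) @\<^sub>v (c @\<^sub>v d) = 0\<^sub>v ((n1 + n2) + (n3 + n4))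
    \<longleftrightarrow> a = 0\<^sub>v n1 \<and> b = 0\<^sub>v n2 \<and> c = 0\<^sub>v n3 \<and> d = 0\<^sub>v n4"
  using assms append_zero_vec_iff[of "a @\<^sub>v b" "n1 + n2" "c @\<^sub>v d" "n3 + n4"]
    append_zero_vec_iff[OF assms(1,2)] append_zero_vec_iff[OF assms(3,4)] by auto

lemma append_vec_four_cases:
  assumes "v \<in> carrier_vec ((n1 + n2) + (n3 + n4))"
  obtains a b c d where "a \<in> carrier_vec n1" "b \<in> carrier_vec n2" "c \<in> carrier_vec n3"
    "d \<in> carrier_vec n4" "v = (a @\<^sub>v b) @\<^sub>v (c @\<^sub>v d)"
proof -
  have split: "\<exists>x\<in>carrier_vec k. \<exists>y\<in>carrier_vec l. w = x @\<^sub>v y"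
    if "w \<in> carrier_vec (k + l)" for w :: "'a vec" and k l
    using that vec_first_last_append[OF that] by (metis vec_first_carrier vec_last_carrier)
  then obtain x y where "x \<in> carrier_vec (n1 + n2)" "y \<in> carrier_vec (n3 + n4)" "v = x @\<^sub>v y"
    using split[OF assms] by blast
  then show ?thesis using split[of x n1 n2] split[of y n3 n4] that by blast
qed

lemma scalar_prod_append_four:
  assumes "a \<in> carrier_vec n1" "b \<in> carrier_vec n2" "c \<in> carrier_vec n3" "d \<in> carrier_vec n4"
    and "a' \<in> carrier_vec n1" "b' \<in> carrier_vec n2" "c' \<in> carrier_vec n3" "d' \<in> carrier_vec n4"
  shows "((a @\<^sub>v b) @\<^sub>v (c @\<^sub>v d)) \<bullet> ((a' @\<^sub>v b') @\<^sub>v (c' @\<^sub>v d'))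
    = a \<bullet> a' + b \<bullet> b' + (c \<bullet> c' + d \<bullet> d')"
proof -
  have "a @\<^sub>v b \<in> carrier_vec (n1 + n2)" "a' @\<^sub>v b' \<in> carrier_vec (n1 + n2)"
    "c @\<^sub>v d \<in> carrier_vec (n3 + n4)" "c' @\<^sub>v d' \<in> carrier_vec (n3 + n4)"
    using assms by auto
  then show ?thesis
    using scalar_prod_append[OF assms(1,2,5,6)] scalar_prod_append[OF assms(3,4,7,8)]
    by (simp only: scalar_prod_append)
qed

lemma scalar_prod_add_four:
  assumes "x \<in> carrier_vec n" "a \<in> carrier_vec n" "b \<in> carrier_vec n" "c \<in> carrier_vec n"
    "d \<in> carrier_vec n"
  shows "x \<bullet> ((a + b) + (c + d)) = x \<bullet> a + (x \<bullet> b + (x \<bullet> c + x \<bullet> d))"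
  using assms by (simp add: scalar_prod_add_distrib[of _ n])

context
  fixes n1 n2 n3 n4 :: nat and M11 M22 M33 M44 M21 M31 M32 M41 M42 M43 :: "real mat"
  assumes diag: "M11 \<in> carrier_mat n1 n1" "M22 \<in> carrier_mat n2 n2"
      "M33 \<in> carrier_mat n3 n3" "M44 \<in> carrier_mat n4 n4"
    and sym: "M11\<^sup>T = M11" "M22\<^sup>T = M22" "M33\<^sup>T = M33" "M44\<^sup>T = M44"
    and lower: "M21 \<in> carrier_mat n2 n1" "M31 \<in> carrier_mat n3 n1" "M32 \<in> carrier_mat n3 n2"
      "M41 \<in> carrier_mat n4 n1" "M42 \<in> carrier_mat n4 n2" "M43 \<in> carrier_mat n4 n3"
begin

text \<open>Only the diagonal and the lower blocks are parameters. Symmetry is thereby built in, and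
  each off-diagonal pair contributes one doubled term to the quadratic form.\<close>

private abbreviation "blocks \<equiv> block_mat4 M11 M21\<^sup>T M31\<^sup>T M41\<^sup>T M21 M22 M32\<^sup>T M42\<^sup>T
  M31 M32 M33 M43\<^sup>T M41 M42 M43 M44"

lemma block_mat4_carrier: "blocks \<in> carrier_mat ((n1 + n2) + (n3 + n4)) ((n1 + n2) + (n3 + n4))"
  unfolding block_mat4_def using diag lower by (intro four_block_carrier_mat) auto

lemma block_mat4_transpose: "blocks\<^sup>T = blocks"
proof -
  have c: "four_block_mat M11 M21\<^sup>T M21 M22 \<in> carrier_mat (n1 + n2) (n1 + n2)"
    "four_block_mat M31\<^sup>T M41\<^sup>T M32\<^sup>T M42\<^sup>T \<in> carrier_mat (n1 + n2) (n3 + n4)"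
    "four_block_mat M31 M32 M41 M42 \<in> carrier_mat (n3 + n4) (n1 + n2)"
    "four_block_mat M33 M43\<^sup>T M43 M44 \<in> carrier_mat (n3 + n4) (n3 + n4)"
    using diag lower by auto
  show ?thesis
    unfolding block_mat4_def transpose_four_block_mat[OF c]
    using diag lower sym
    by (simp add: transpose_four_block_mat[of _ n1 n1 _ n2 _ n2]
        transpose_four_block_mat[of _ n1 n3 _ n4 _ n2] transpose_four_block_mat[of _ n3 n1 _ n2 _ n4]
        transpose_four_block_mat[of _ n3 n3 _ n4 _ n4])
qed

lemma block_mat4_form:
  assumes v: "a \<in> carrier_vec n1" "b \<in> carrier_vec n2" "c \<in> carrier_vec n3" "d \<in> carrier_vec n4"
  shows "((a @\<^sub>v b) @\<^sub>v (c @\<^sub>v d)) \<bullet> (blocks *\<^sub>v ((a @\<^sub>v b) @\<^sub>v (c @\<^sub>v d)))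
    = a \<bullet> (M11 *\<^sub>v a) + b \<bullet> (M22 *\<^sub>v b) + c \<bullet> (M33 *\<^sub>v c) + d \<bullet> (M44 *\<^sub>v d)
      + 2 * (b \<bullet> (M21 *\<^sub>v a) + c \<bullet> (M31 *\<^sub>v a) + c \<bullet> (M32 *\<^sub>v b)
        + d \<bullet> (M41 *\<^sub>v a) + d \<bullet> (M42 *\<^sub>v b) + d \<bullet> (M43 *\<^sub>v c))"
proof -
  have T: "M21\<^sup>T \<in> carrier_mat n1 n2" "M31\<^sup>T \<in> carrier_mat n1 n3" "M32\<^sup>T \<in> carrier_mat n2 n3"
      "M41\<^sup>T \<in> carrier_mat n1 n4" "M42\<^sup>T \<in> carrier_mat n2 n4" "M43\<^sup>T \<in> carrier_mat n3 n4"
    using lower by auto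
  have c: "four_block_mat M11 M21\<^sup>T M21 M22 \<in> carrier_mat (n1 + n2) (n1 + n2)"
    "four_block_mat M31\<^sup>T M41\<^sup>T M32\<^sup>T M42\<^sup>T \<in> carrier_mat (n1 + n2) (n3 + n4)"
    "four_block_mat M31 M32 M41 M42 \<in> carrier_mat (n3 + n4) (n1 + n2)"
    "four_block_mat M33 M43\<^sup>T M43 M44 \<in> carrier_mat (n3 + n4) (n3 + n4)"
    using diag lower by auto
  have ab: "a @\<^sub>v b \<in> carrier_vec (n1 + n2)" "c @\<^sub>v d \<in> carrier_vec (n3 + n4)" using v by auto
  note cv = diag[THEN mult_mat_vec_carrier] lower[THEN mult_mat_vec_carrier]
    T[THEN mult_mat_vec_carrier]
  have u: "M11 *\<^sub>v a + M21\<^sup>T *\<^sub>v b \<in> carrier_vec n1" "M31\<^sup>T *\<^sub>v c + M41\<^sup>T *\<^sub>v d \<in> carrier_vec n1"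
    "M21 *\<^sub>v a + M22 *\<^sub>v b \<in> carrier_vec n2" "M32\<^sup>T *\<^sub>v c + M42\<^sup>T *\<^sub>v d \<in> carrier_vec n2"
    "M31 *\<^sub>v a + M32 *\<^sub>v b \<in> carrier_vec n3" "M33 *\<^sub>v c + M43\<^sup>T *\<^sub>v d \<in> carrier_vec n3"
    "M41 *\<^sub>v a + M42 *\<^sub>v b \<in> carrier_vec n4" "M43 *\<^sub>v c + M44 *\<^sub>v d \<in> carrier_vec n4"
    by (intro add_carrier_vec cv v)+
  have eq: "blocks *\<^sub>v ((a @\<^sub>v b) @\<^sub>v (c @\<^sub>v d)) =
    (((M11 *\<^sub>v a + M21\<^sup>T *\<^sub>v b) + (M31\<^sup>T *\<^sub>v c + M41\<^sup>T *\<^sub>v d))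
      @\<^sub>v ((M21 *\<^sub>v a + M22 *\<^sub>v b) + (M32\<^sup>T *\<^sub>v c + M42\<^sup>T *\<^sub>v d)))
    @\<^sub>v (((M31 *\<^sub>v a + M32 *\<^sub>v b) + (M33 *\<^sub>v c + M43\<^sup>T *\<^sub>v d))
      @\<^sub>v ((M41 *\<^sub>v a + M42 *\<^sub>v b) + (M43 *\<^sub>v c + M44 *\<^sub>v d)))"
    unfolding block_mat4_def four_block_mat_mult_vec[OF c ab]
      four_block_mat_mult_vec[OF diag(1) T(1) lower(1) diag(2) v(1,2)]
      four_block_mat_mult_vec[OF T(2,4,3,5) v(3,4)]
      four_block_mat_mult_vec[OF lower(2,3,4,5) v(1,2)]
      four_block_mat_mult_vec[OF diag(3) T(6) lower(6) diag(4) v(3,4)]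
      append_vec_add[OF u(1-4)] append_vec_add[OF u(5-8)] ..
  have tr: "a \<bullet> (M21\<^sup>T *\<^sub>v b) = b \<bullet> (M21 *\<^sub>v a)" "a \<bullet> (M31\<^sup>T *\<^sub>v c) = c \<bullet> (M31 *\<^sub>v a)"
    "a \<bullet> (M41\<^sup>T *\<^sub>v d) = d \<bullet> (M41 *\<^sub>v a)" "b \<bullet> (M32\<^sup>T *\<^sub>v c) = c \<bullet> (M32 *\<^sub>v b)"
    "b \<bullet> (M42\<^sup>T *\<^sub>v d) = d \<bullet> (M42 *\<^sub>v b)" "c \<bullet> (M43\<^sup>T *\<^sub>v d) = d \<bullet> (M43 *\<^sub>v c)"
    using form_transpose lower v by metis+
  show ?thesis
    unfolding eq scalar_prod_append_four[OF v add_carrier_vec[OF u(1,2)] add_carrier_vec[OF u(3,4)]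
      add_carrier_vec[OF u(5,6)] add_carrier_vec[OF u(7,8)]]
    scalar_prod_add_four[OF v(1) cv(1)[OF v(1)] cv(11)[OF v(2)] cv(12)[OF v(3)] cv(14)[OF v(4)]]
    scalar_prod_add_four[OF v(2) cv(5)[OF v(1)] cv(2)[OF v(2)] cv(13)[OF v(3)] cv(15)[OF v(4)]]
    scalar_prod_add_four[OF v(3) cv(6)[OF v(1)] cv(7)[OF v(2)] cv(3)[OF v(3)] cv(16)[OF v(4)]]
    scalar_prod_add_four[OF v(4) cv(8)[OF v(1)] cv(9)[OF v(2)] cv(10)[OF v(3)] cv(4)[OF v(4)]] tr
    by simp
qed

end

section \<open>The kernel of \<open>B_hat\<close> and restriction to it\<close>

lemma vec_eqI_scalar_prod:
  fixes u w :: "real vec"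
  assumes "u \<in> carrier_vec n" "w \<in> carrier_vec n"
    and "\<And>x. x \<in> carrier_vec n \<Longrightarrow> x \<bullet> u = x \<bullet> w"
  shows "u = w"
proof (rule eq_vecI)
  fix i assume "i < dim_vec w"
  then show "u $ i = w $ i"
    using assms(3)[of "unit_vec n i"] assms(1,2) by (simp add: scalar_prod_left_unit[of _ n])
qed (use assms in simp)

text \<open>\<open>B_hat\<close> is the transpose of a stacked column G, so its product with v is
  identified by duality: w . (B_hat v) = v . (G w) for every w, and G w is computed block by
  block.\<close>

lemma B_hat_mult_vec:
  fixes B :: "real mat"
  assumes B: "B \<in> carrier_mat n k"
    and v: "a \<in> carrier_vec n" "b \<in> carrier_vec n" "c \<in> carrier_vec n" "d \<in> carrier_vec k"
  shows "B_hat n k B \<in> carrier_mat k ((n + n) + (n + k))"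
    and "B_hat n k B *\<^sub>v ((a @\<^sub>v b) @\<^sub>v (c @\<^sub>v d)) = B\<^sup>T *\<^sub>v b + d"
proof -
  define G where "G = 0\<^sub>m n k @\<^sub>r B @\<^sub>r 0\<^sub>m n k @\<^sub>r (1\<^sub>m k :: real mat)"
  have c: "0\<^sub>m n k @\<^sub>r (1\<^sub>m k :: real mat) \<in> carrier_mat (n + k) k"
    "B @\<^sub>r 0\<^sub>m n k @\<^sub>r (1\<^sub>m k :: real mat) \<in> carrier_mat (n + (n + k)) k"
    using B by (auto simp del: carrier_matI)
  have "G \<in> carrier_mat (n + (n + (n + k))) k" unfolding G_def using c B by auto
  then have G: "G \<in> carrier_mat ((n + n) + (n + k)) k" by (simp add: add.assoc)
  then show hat: "B_hat n k B \<in> carrier_mat k ((n + n) + (n + k))"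
    unfolding B_hat_def G_def[symmetric] by simp
  let ?v = "(a @\<^sub>v b) @\<^sub>v (c @\<^sub>v d)"
  have vc: "?v \<in> carrier_vec ((n + n) + (n + k))" using v by auto
  have BT: "B\<^sup>T \<in> carrier_mat k n" using B by simp
  have Gw: "G *\<^sub>v w = (0\<^sub>v n @\<^sub>v B *\<^sub>v w) @\<^sub>v (0\<^sub>v n @\<^sub>v w)" if w: "w \<in> carrier_vec k" for w
  proof -
    have "G *\<^sub>v w = 0\<^sub>v n @\<^sub>v B *\<^sub>v w @\<^sub>v 0\<^sub>v n @\<^sub>v w"
      unfolding G_def mat_mult_append[OF zero_carrier_mat c(2) w] mat_mult_append[OF B c(1) w]
        mat_mult_append[OF zero_carrier_mat one_carrier_mat w] zero_mult_mat_vec[OF w]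
      using w by simp
    \<comment> \<open>Stacking nests to the right, whereas \<open>block_mat4\<close> groups the
      blocks two by two.\<close>
    also have "\<dots> = (0\<^sub>v n @\<^sub>v B *\<^sub>v w) @\<^sub>v (0\<^sub>v n @\<^sub>v w)"
      using B w by (intro eq_vecI) (auto simp: add.assoc)
    finally show ?thesis .
  qed
  show "B_hat n k B *\<^sub>v ?v = B\<^sup>T *\<^sub>v b + d"
  proof (rule vec_eqI_scalar_prod[of _ k])
    show "B_hat n k B *\<^sub>v ?v \<in> carrier_vec k" using hat vc by (rule mult_mat_vec_carrier)
    show "B\<^sup>T *\<^sub>v b + d \<in> carrier_vec k" using BT v by simp
    fix w :: "real vec" assume w: "w \<in> carrier_vec k"
    have Bw: "B *\<^sub>v w \<in> carrier_vec n" using B w by simp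
    have "w \<bullet> (B_hat n k B *\<^sub>v ?v) = ?v \<bullet> (G *\<^sub>v w)"
      unfolding B_hat_def G_def[symmetric] using form_transpose[OF G vc w] by simp
    also have "\<dots> = b \<bullet> (B *\<^sub>v w) + d \<bullet> w"
      unfolding Gw[OF w] using v w Bw
      by (simp add: scalar_prod_append[of _ "n + n" _ "n + k"] scalar_prod_append[of _ n _ n]
          scalar_prod_append[of _ n _ k])
    also have "\<dots> = w \<bullet> (B\<^sup>T *\<^sub>v b + d)"
      using form_transpose[OF B v(2) w] comm_scalar_prod[OF v(4) w]
        scalar_prod_add_distrib[OF w mult_mat_vec_carrier[OF BT v(2)] v(4)] by simp
    finally show "w \<bullet> (B_hat n k B *\<^sub>v ?v) = w \<bullet> (B\<^sup>T *\<^sub>v b + d)" .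
  qed
qed

text \<open>The map w -> K w is a bijection onto the kernel of M: onto because the columns span it,
  injective because K^T K = 1. The form of K^T H K at w is that of H at K w.\<close>

lemma orthonormal_null_basis_neg_def_iff:
  fixes M K H :: "real mat"
  assumes M: "M \<in> carrier_mat k l" and K: "orthonormal_null_basis M K"
    and H: "H \<in> carrier_mat l l" "H\<^sup>T = H"
  shows "neg_def (K\<^sup>T * H * K)
    \<longleftrightarrow> (\<forall>v\<in>carrier_vec l. M *\<^sub>v v = 0\<^sub>v k \<longrightarrow> v \<noteq> 0\<^sub>v l \<longrightarrow> v \<bullet> (H *\<^sub>v v) < 0)"
proof -
  define p where "p = dim_col K"
  have Kc: "K \<in> carrier_mat l p" and KK: "K\<^sup>T * K = 1\<^sub>m p"
    and span: "vec_space.col_space l K = mat_kernel M"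
    using K M unfolding orthonormal_null_basis_def p_def by auto
  have "{K *\<^sub>v w | w. w \<in> carrier_vec p} = vec_space.col_space l K"
    using mult_mat_vec_carrier[OF Kc] unfolding vec_space.col_space_eq[OF Kc] carrier_matD[OF Kc]
    by blast
  then have ker: "{K *\<^sub>v w | w. w \<in> carrier_vec p} = {v \<in> carrier_vec l. M *\<^sub>v v = 0\<^sub>v k}"
    using span mat_kernel[OF M] by simp
  have KT: "K\<^sup>T \<in> carrier_mat p l" using Kc by simp
  have KH: "K\<^sup>T * H \<in> carrier_mat p l" using KT H(1) by simp
  have KHK: "K\<^sup>T * H * K \<in> carrier_mat p p" using KH Kc by simp
  have inj: "K *\<^sub>v w = 0\<^sub>v l \<longleftrightarrow> w = 0\<^sub>v p" if w: "w \<in> carrier_vec p" for w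
  proof
    assume "K *\<^sub>v w = 0\<^sub>v l"
    then have "(K\<^sup>T * K) *\<^sub>v w = K\<^sup>T *\<^sub>v 0\<^sub>v l" using assoc_mult_mat_vec[OF KT Kc w] by simp
    then show "w = 0\<^sub>v p" using KK w mult_mat_zero_vec[OF KT] by simp
  qed (simp add: mult_mat_zero_vec[OF Kc])
  have "(K\<^sup>T * H)\<^sup>T = H * K" using transpose_mult[OF KT H(1)] H(2) by simp
  then have "(K\<^sup>T * H * K)\<^sup>T = K\<^sup>T * H * K"
    using transpose_mult[OF KH Kc] assoc_mult_mat[OF KT H(1) Kc] by simp
  moreover have "w \<bullet> ((K\<^sup>T * H * K) *\<^sub>v w) = (K *\<^sub>v w) \<bullet> (H *\<^sub>v (K *\<^sub>v w))"
    if w: "w \<in> carrier_vec p" for w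
  proof -
    have Kw: "K *\<^sub>v w \<in> carrier_vec l" using mult_mat_vec_carrier[OF Kc w] .
    have HKw: "H *\<^sub>v (K *\<^sub>v w) \<in> carrier_vec l" using mult_mat_vec_carrier[OF H(1) Kw] .
    show ?thesis
      unfolding assoc_mult_mat_vec[OF KH Kc w] assoc_mult_mat_vec[OF KT H(1) Kw]
      using form_transpose[OF KT w HKw] comm_scalar_prod[OF HKw Kw] by simp
  qed
  ultimately have "neg_def (K\<^sup>T * H * K)
    \<longleftrightarrow> (\<forall>w\<in>carrier_vec p. K *\<^sub>v w \<noteq> 0\<^sub>v l \<longrightarrow> (K *\<^sub>v w) \<bullet> (H *\<^sub>v (K *\<^sub>v w)) < 0)"
    unfolding neg_def_def using carrier_matD(1)[OF KHK] inj by simp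
  also have "\<dots> \<longleftrightarrow> (\<forall>v\<in>{K *\<^sub>v w | w. w \<in> carrier_vec p}. v \<noteq> 0\<^sub>v l \<longrightarrow> v \<bullet> (H *\<^sub>v v) < 0)"
    by blast
  finally show ?thesis unfolding ker by blast
qed

section \<open>Completing squares\<close>

lemma form_young:
  assumes P: "P \<in> carrier_mat n n" "pos_semidef P" and v: "x \<in> carrier_vec n" "y \<in> carrier_vec n"
  shows "2 * (x \<bullet> (P *\<^sub>v y)) \<le> x \<bullet> (P *\<^sub>v x) + y \<bullet> (P *\<^sub>v y)"
proof -
  have T: "P\<^sup>T = P" using P by (simp add: pos_semidef_def)
  have "x + (- 1) \<cdot>\<^sub>v y \<in> carrier_vec n" using v by simp
  then have "0 \<le> (x + (- 1) \<cdot>\<^sub>v y) \<bullet> (P *\<^sub>v (x + (- 1) \<cdot>\<^sub>v y))"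
    using P unfolding pos_semidef_def carrier_matD(1)[OF P(1)] by blast
  then show ?thesis unfolding form_add_scaled[OF P(1) T v] by simp
qed

text \<open>Fenchel's inequality between the form of P and that of its inverse: Young's inequality
  at y = P^-1 b. It accounts for the inverses of P and R on the diagonal of
  \<open>Phi\<close>.\<close>

lemma form_young_inv:
  assumes P: "P \<in> carrier_mat n n" "pos_def P" and v: "x \<in> carrier_vec n" "b \<in> carrier_vec n"
  shows "2 * (b \<bullet> x) \<le> x \<bullet> (P *\<^sub>v x) + b \<bullet> (mat_inv P *\<^sub>v b)"
proof -
  have y: "mat_inv P *\<^sub>v b \<in> carrier_vec n"
    using mult_mat_vec_carrier[OF mat_inv_pos_def(1)[OF P] v(2)] .
  show ?thesis
    using form_young[OF P(1) pos_def_imp_semidef[OF P] v(1) y] mat_inv_mult_vec(1)[OF P v(2)]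
      comm_scalar_prod[OF v] comm_scalar_prod[OF v(2) y] by simp
qed

lemma vec_young:
  fixes x y :: "real vec"
  assumes "x \<in> carrier_vec n" "y \<in> carrier_vec n"
  shows "2 * (x \<bullet> y) \<le> x \<bullet> x + y \<bullet> y"
  using form_young[OF one_carrier_mat pos_semidef_one assms] assms by simp

lemma pos_def_form_nonneg:
  assumes "P \<in> carrier_mat n n" "pos_def P" "x \<in> carrier_vec n"
  shows "0 \<le> x \<bullet> (P *\<^sub>v x)"
  using pos_def_imp_semidef[OF assms(1,2)] assms(3) carrier_matD(1)[OF assms(1)]
  by (simp add: pos_semidef_def)

lemma pos_def_form_pos:
  assumes "P \<in> carrier_mat n n" "pos_def P" "x \<in> carrier_vec n" "x \<noteq> 0\<^sub>v n"
  shows "0 < x \<bullet> (P *\<^sub>v x)"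
  using assms(2-4) carrier_matD(1)[OF assms(1)] by (simp add: pos_def_def)

lemma symmetric_square_form:
  fixes S :: "real mat"
  assumes S: "S \<in> carrier_mat n n" "S\<^sup>T = S" and x: "x \<in> carrier_vec n"
  shows "(S *\<^sub>v x) \<bullet> (S *\<^sub>v x) = x \<bullet> ((S * S) *\<^sub>v x)"
proof -
  have Sx: "S *\<^sub>v x \<in> carrier_vec n" using mult_mat_vec_carrier[OF S(1) x] .
  show ?thesis
    unfolding assoc_mult_mat_vec[OF S(1,1) x] using form_symmetric[OF S Sx x] by simp
qed

lemma psd_sqrt_form:
  assumes "Q \<in> carrier_mat n n" "pos_semidef Q" "x \<in> carrier_vec n"
  shows "(psd_sqrt Q *\<^sub>v x) \<bullet> (psd_sqrt Q *\<^sub>v x) = x \<bullet> (Q *\<^sub>v x)"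
  using symmetric_square_form[OF psd_sqrt(1,2)[OF assms(1,2)] assms(3)] psd_sqrt(3)[OF assms(1,2)]
  by simp

lemma scalar_prod_uminus_one:
  fixes x :: "real vec"
  shows "x \<in> carrier_vec n \<Longrightarrow> x \<bullet> ((- 1\<^sub>m n) *\<^sub>v x) = - (x \<bullet> x)"
  by simp

lemma form_uminus:
  fixes M :: "real mat"
  assumes "M \<in> carrier_mat n n" "x \<in> carrier_vec n"
  shows "x \<bullet> ((- M) *\<^sub>v x) = - (x \<bullet> (M *\<^sub>v x))"
  using assms by simp

lemma uminus_symmetric: "M\<^sup>T = M \<Longrightarrow> (- M)\<^sup>T = - (M :: real mat)"
  by (metis transpose_uminus)

text \<open>A and B stand for the matrices A^i and B^i of the fixed player. The strict matrix
  inequality is stated through its values at vectors, with the input cost taken at F x, the shape in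
  which squares are completed.\<close>

definition lyapunov_decrease ::
  "nat \<Rightarrow> real mat \<Rightarrow> real mat \<Rightarrow> real mat \<Rightarrow> real mat \<Rightarrow> real mat \<Rightarrow> real mat \<Rightarrow> bool" where
  "lyapunov_decrease n A B Q R P F \<longleftrightarrow> (\<forall>x\<in>carrier_vec n. x \<noteq> 0\<^sub>v n \<longrightarrow>
    ((A + B * F) *\<^sub>v x) \<bullet> (P *\<^sub>v ((A + B * F) *\<^sub>v x))
      + x \<bullet> (Q *\<^sub>v x) + (F *\<^sub>v x) \<bullet> (R *\<^sub>v (F *\<^sub>v x)) < x \<bullet> (P *\<^sub>v x))"

lemma uminus_vec_eq_smult: "- v = (- 1) \<cdot>\<^sub>v (v :: real vec)"
  by (intro eq_vecI) auto

context
  fixes n k :: nat and A B Q R P :: "real mat"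
  assumes A: "A \<in> carrier_mat n n" and B: "B \<in> carrier_mat n k"
    and Q: "Q \<in> carrier_mat n n" "pos_semidef Q"
    and R: "R \<in> carrier_mat k k" "pos_def R"
    and P: "P \<in> carrier_mat n n" "pos_def P"
begin

text \<open>Young's inequality on the three cross terms absorbs all diagonal terms in b, c and d.
  What remains is the Lyapunov difference at a, strictly negative for nonzero a; at a = 0 the cross
  terms vanish and a sum of negative squares is left.\<close>

lemma lyapunov_decrease_imp_neg_def:
  assumes F: "F \<in> carrier_mat k n" and dec: "lyapunov_decrease n A B Q R P F"
  shows "neg_def (block_mat4
    (- P) ((A + B * F)\<^sup>T * P) ((psd_sqrt Q)\<^sup>T) ((psd_sqrt R * F)\<^sup>T)
    (P * (A + B * F)) (- P) (0\<^sub>m n n) (0\<^sub>m n k)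
    (psd_sqrt Q) (0\<^sub>m n n) (- 1\<^sub>m n) (0\<^sub>m n k)
    (psd_sqrt R * F) (0\<^sub>m k n) (0\<^sub>m k n) (- 1\<^sub>m k))" (is "neg_def ?X")
proof -
  define M where "M = A + B * F"
  have M: "M \<in> carrier_mat n n" using A B F by (simp add: M_def)
  note Rp = pos_def_imp_semidef[OF R]
  note S = psd_sqrt[OF Q] and SR = psd_sqrt[OF R(1) Rp]
  have T: "P\<^sup>T = P" using P by (simp add: pos_def_def)
  have PM: "P * M \<in> carrier_mat n n" using P M by simp
  have SF: "psd_sqrt R * F \<in> carrier_mat k n" using SR F by simp
  \<comment> \<open>In the order of the assumptions about block matrices: four diagonal carriers,
    four symmetries, then the lower blocks 21, 31, 32, 41, 42, 43.\<close>
  note ingredients = uminus_carrier_mat[OF P(1)] uminus_carrier_mat[OF P(1)]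
    uminus_carrier_mat[OF one_carrier_mat] uminus_carrier_mat[OF one_carrier_mat]
    uminus_symmetric[OF T] uminus_symmetric[OF T] uminus_symmetric[OF transpose_one]
    uminus_symmetric[OF transpose_one]
    PM S(1) zero_carrier_mat SF zero_carrier_mat zero_carrier_mat
  define X where "X = block_mat4 (- P) (P * M)\<^sup>T (psd_sqrt Q)\<^sup>T (psd_sqrt R * F)\<^sup>T
    (P * M) (- P) (0\<^sub>m n n)\<^sup>T (0\<^sub>m k n)\<^sup>T
    (psd_sqrt Q) (0\<^sub>m n n) (- 1\<^sub>m n) (0\<^sub>m k n)\<^sup>T
    (psd_sqrt R * F) (0\<^sub>m k n) (0\<^sub>m k n) (- 1\<^sub>m k)"
  have X: "?X = X" using transpose_mult[OF P(1) M] T unfolding X_def M_def by simp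
  note carrier = block_mat4_carrier[OF ingredients, folded X_def]
  have "v \<bullet> (X *\<^sub>v v) < 0" if v: "v \<in> carrier_vec ((n + n) + (n + k))" "v \<noteq> 0\<^sub>v ((n + n) + (n + k))" for v
  proof -
    obtain a b c d where abcd: "a \<in> carrier_vec n" "b \<in> carrier_vec n" "c \<in> carrier_vec n"
      "d \<in> carrier_vec k" and veq: "v = (a @\<^sub>v b) @\<^sub>v (c @\<^sub>v d)"
      using append_vec_four_cases[OF v(1)] .
    have Ma: "M *\<^sub>v a \<in> carrier_vec n" using M abcd by simp
    have Fa: "F *\<^sub>v a \<in> carrier_vec k" using F abcd by simp
    have Sa: "psd_sqrt Q *\<^sub>v a \<in> carrier_vec n" using S(1) abcd by simp
    have SFa: "psd_sqrt R *\<^sub>v (F *\<^sub>v a) \<in> carrier_vec k" using SR(1) Fa by simp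
    have form: "v \<bullet> (X *\<^sub>v v) = - (a \<bullet> (P *\<^sub>v a)) - b \<bullet> (P *\<^sub>v b) - c \<bullet> c - d \<bullet> d
      + 2 * (b \<bullet> (P *\<^sub>v (M *\<^sub>v a))) + 2 * (c \<bullet> (psd_sqrt Q *\<^sub>v a))
      + 2 * (d \<bullet> (psd_sqrt R *\<^sub>v (F *\<^sub>v a)))"
      unfolding veq X_def block_mat4_form[OF ingredients abcd]
        form_uminus[OF P(1) abcd(1)] form_uminus[OF P(1) abcd(2)]
        scalar_prod_uminus_one[OF abcd(3)] scalar_prod_uminus_one[OF abcd(4)]
        assoc_mult_mat_vec[OF P(1) M abcd(1)] assoc_mult_mat_vec[OF SR(1) F abcd(1)]
        zero_mult_mat_vec[OF abcd(1)] zero_mult_mat_vec[OF abcd(2)] zero_mult_mat_vec[OF abcd(3)]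
        scalar_prod_right_zero[OF abcd(3)] scalar_prod_right_zero[OF abcd(4)] by simp
    have young: "2 * (b \<bullet> (P *\<^sub>v (M *\<^sub>v a))) \<le> b \<bullet> (P *\<^sub>v b) + (M *\<^sub>v a) \<bullet> (P *\<^sub>v (M *\<^sub>v a))"
      "2 * (c \<bullet> (psd_sqrt Q *\<^sub>v a)) \<le> c \<bullet> c + a \<bullet> (Q *\<^sub>v a)"
      "2 * (d \<bullet> (psd_sqrt R *\<^sub>v (F *\<^sub>v a))) \<le> d \<bullet> d + (F *\<^sub>v a) \<bullet> (R *\<^sub>v (F *\<^sub>v a))"
      using form_young[OF P(1) pos_def_imp_semidef[OF P] abcd(2) Ma] vec_young[OF abcd(3) Sa]
        vec_young[OF abcd(4) SFa] psd_sqrt_form[OF Q abcd(1)] psd_sqrt_form[OF R(1) Rp Fa] by auto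
    show ?thesis
    proof (cases "a = 0\<^sub>v n")
      case False
      then have "(M *\<^sub>v a) \<bullet> (P *\<^sub>v (M *\<^sub>v a)) + a \<bullet> (Q *\<^sub>v a) + (F *\<^sub>v a) \<bullet> (R *\<^sub>v (F *\<^sub>v a))
        < a \<bullet> (P *\<^sub>v a)"
        using dec abcd(1) unfolding lyapunov_decrease_def M_def by blast
      then show ?thesis using form young by linarith
    next
      case True
      have nz: "b \<noteq> 0\<^sub>v n \<or> c \<noteq> 0\<^sub>v n \<or> d \<noteq> 0\<^sub>v k"
        using v(2) append_vec_four_zero_iff[OF abcd] True veq by auto
      have form0: "v \<bullet> (X *\<^sub>v v) = - (b \<bullet> (P *\<^sub>v b)) - c \<bullet> c - d \<bullet> d"
        unfolding form True mult_mat_zero_vec[OF M] mult_mat_zero_vec[OF P(1)]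
          mult_mat_zero_vec[OF F] mult_mat_zero_vec[OF S(1)] mult_mat_zero_vec[OF SR(1)]
          scalar_prod_right_zero[OF abcd(2)] scalar_prod_right_zero[OF abcd(3)]
          scalar_prod_right_zero[OF abcd(4)] by simp
      show ?thesis
        using nz pos_def_form_pos[OF P abcd(2)] pos_def_form_nonneg[OF P abcd(2)]
          scalar_prod_self(1)[of c] scalar_prod_self(1)[of d]
          scalar_prod_self_pos[OF abcd(3)] scalar_prod_self_pos[OF abcd(4)]
        unfolding form0 by linarith
    qed
  qed
  then show ?thesis
    unfolding X neg_def_def carrier_matD[OF carrier]
    using block_mat4_transpose[OF ingredients, folded X_def] by blast
qed

lemma Phi_carrier: "Phi n k A Q R (mat_inv P) \<in> carrier_mat ((n + n) + (n + k)) ((n + n) + (n + k))"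
    (is ?carrier)
  and Phi_symmetric: "(Phi n k A Q R (mat_inv P))\<^sup>T = Phi n k A Q R (mat_inv P)" (is ?sym)
  and Phi_form: "\<lbrakk>a \<in> carrier_vec n; b \<in> carrier_vec n; c \<in> carrier_vec n; d \<in> carrier_vec k\<rbrakk> \<Longrightarrow>
    ((a @\<^sub>v b) @\<^sub>v (c @\<^sub>v d)) \<bullet> (Phi n k A Q R (mat_inv P) *\<^sub>v ((a @\<^sub>v b) @\<^sub>v (c @\<^sub>v d)))
    = - (a \<bullet> (mat_inv P *\<^sub>v a)) - b \<bullet> (mat_inv P *\<^sub>v b) - c \<bullet> c - d \<bullet> (mat_inv R *\<^sub>v d)
      + 2 * (b \<bullet> (A *\<^sub>v (mat_inv P *\<^sub>v a))) + 2 * (c \<bullet> (psd_sqrt Q *\<^sub>v (mat_inv P *\<^sub>v a)))"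
    (is "PROP ?form")
proof -
  let ?Y = "mat_inv P"
  note Y = mat_inv_pos_def(1)[OF P] and YT = mat_inv_symmetric[OF P]
  note Ri = mat_inv_pos_def(1)[OF R] and RiT = mat_inv_symmetric[OF R]
  note S = psd_sqrt[OF Q]
  have AY: "A * ?Y \<in> carrier_mat n n" and SY: "psd_sqrt Q * ?Y \<in> carrier_mat n n"
    using A S Y by auto
  note ingredients = uminus_carrier_mat[OF Y] uminus_carrier_mat[OF Y]
    uminus_carrier_mat[OF one_carrier_mat] uminus_carrier_mat[OF Ri]
    uminus_symmetric[OF YT] uminus_symmetric[OF YT] uminus_symmetric[OF transpose_one]
    uminus_symmetric[OF RiT]
    AY SY zero_carrier_mat zero_carrier_mat zero_carrier_mat zero_carrier_mat
  have Phi: "Phi n k A Q R ?Y = block_mat4 (- ?Y) (A * ?Y)\<^sup>T (psd_sqrt Q * ?Y)\<^sup>T (0\<^sub>m k n)\<^sup>T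
    (A * ?Y) (- ?Y) (0\<^sub>m n n)\<^sup>T (0\<^sub>m k n)\<^sup>T
    (psd_sqrt Q * ?Y) (0\<^sub>m n n) (- 1\<^sub>m n) (0\<^sub>m k n)\<^sup>T
    (0\<^sub>m k n) (0\<^sub>m k n) (0\<^sub>m k n) (- mat_inv R)"
    unfolding Phi_def using transpose_mult[OF A Y] YT by simp
  show ?carrier unfolding Phi by (rule block_mat4_carrier[OF ingredients])
  show ?sym unfolding Phi by (rule block_mat4_transpose[OF ingredients])
  show "PROP ?form"
  proof -
    assume abcd: "a \<in> carrier_vec n" "b \<in> carrier_vec n" "c \<in> carrier_vec n" "d \<in> carrier_vec k"
    show ?thesis
      unfolding Phi block_mat4_form[OF ingredients abcd]
        form_uminus[OF Y abcd(1)] form_uminus[OF Y abcd(2)]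
        scalar_prod_uminus_one[OF abcd(3)] form_uminus[OF Ri abcd(4)]
        assoc_mult_mat_vec[OF A Y abcd(1)] assoc_mult_mat_vec[OF S(1) Y abcd(1)]
        zero_mult_mat_vec[OF abcd(1)] zero_mult_mat_vec[OF abcd(2)] zero_mult_mat_vec[OF abcd(3)]
        scalar_prod_right_zero[OF abcd(3)] scalar_prod_right_zero[OF abcd(4)] by simp
  qed
qed

lemma closed_loop_mult_vec:
  assumes F: "F \<in> carrier_mat k n" and x: "x \<in> carrier_vec n"
  shows "(A + B * F) *\<^sub>v x = A *\<^sub>v x + B *\<^sub>v (F *\<^sub>v x)"
  unfolding add_mult_distrib_mat_vec[OF A mult_carrier_mat[OF B F] x] assoc_mult_mat_vec[OF B F x] ..

text \<open>With p = P^-1 a, the kernel condition B^T b + d = 0 gives b . A p = b . M p + d . F p,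
  so the gain can be inserted although \<open>Phi\<close> does not mention it. Young's inequality
  for the pairs (M p, b), (F p, d) and (c, sqrt Q p) then leaves the Lyapunov difference at
  p.\<close>

lemma lyapunov_decrease_imp_Phi_neg:
  assumes F: "F \<in> carrier_mat k n" and dec: "lyapunov_decrease n A B Q R P F"
    and v: "v \<in> carrier_vec ((n + n) + (n + k))" "v \<noteq> 0\<^sub>v ((n + n) + (n + k))"
    and ker: "B_hat n k B *\<^sub>v v = 0\<^sub>v k"
  shows "v \<bullet> (Phi n k A Q R (mat_inv P) *\<^sub>v v) < 0"
proof -
  let ?Y = "mat_inv P"
  note Y = mat_inv_pos_def(1)[OF P] and Ri = mat_inv_pos_def(1)[OF R] and S = psd_sqrt[OF Q]
  obtain a b c d where abcd: "a \<in> carrier_vec n" "b \<in> carrier_vec n" "c \<in> carrier_vec n"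
    "d \<in> carrier_vec k" and veq: "v = (a @\<^sub>v b) @\<^sub>v (c @\<^sub>v d)"
    using append_vec_four_cases[OF v(1)] .
  have BT: "B\<^sup>T \<in> carrier_mat k n" using B by simp
  have BTb: "B\<^sup>T *\<^sub>v b \<in> carrier_vec k" using mult_mat_vec_carrier[OF BT abcd(2)] .
  have sum0: "B\<^sup>T *\<^sub>v b + d = 0\<^sub>v k" using ker B_hat_mult_vec(2)[OF B abcd] veq by simp
  define p where "p = ?Y *\<^sub>v a"
  define M where "M = A + B * F"
  have p: "p \<in> carrier_vec n" using mult_mat_vec_carrier[OF Y abcd(1)] by (simp add: p_def)
  have Pp: "P *\<^sub>v p = a" using mat_inv_mult_vec(1)[OF P abcd(1)] by (simp add: p_def)
  have M: "M \<in> carrier_mat n n" using A B F by (simp add: M_def)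
  have Mp: "M *\<^sub>v p \<in> carrier_vec n" using M p by simp
  have Ap: "A *\<^sub>v p \<in> carrier_vec n" using A p by simp
  have Fp: "F *\<^sub>v p \<in> carrier_vec k" using F p by simp
  have BFp: "B *\<^sub>v (F *\<^sub>v p) \<in> carrier_vec n" using B Fp by simp
  have Sp: "psd_sqrt Q *\<^sub>v p \<in> carrier_vec n" using S(1) p by simp
  have "a \<bullet> p = p \<bullet> (P *\<^sub>v p)" using Pp comm_scalar_prod[OF abcd(1) p] by simp
  then have form: "v \<bullet> (Phi n k A Q R ?Y *\<^sub>v v) = - (p \<bullet> (P *\<^sub>v p)) - b \<bullet> (?Y *\<^sub>v b) - c \<bullet> c
      - d \<bullet> (mat_inv R *\<^sub>v d) + 2 * (b \<bullet> (A *\<^sub>v p)) + 2 * (c \<bullet> (psd_sqrt Q *\<^sub>v p))"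
    unfolding veq Phi_form[OF abcd] p_def[symmetric] by simp
  have "b \<bullet> (M *\<^sub>v p) = b \<bullet> (A *\<^sub>v p) + b \<bullet> (B *\<^sub>v (F *\<^sub>v p))"
    unfolding M_def closed_loop_mult_vec[OF F p] using scalar_prod_add_distrib[OF abcd(2) Ap BFp] .
  moreover have "b \<bullet> (B *\<^sub>v (F *\<^sub>v p)) = (F *\<^sub>v p) \<bullet> (B\<^sup>T *\<^sub>v b)" using form_transpose[OF B abcd(2) Fp] .
  moreover have "(F *\<^sub>v p) \<bullet> (B\<^sup>T *\<^sub>v b) + (F *\<^sub>v p) \<bullet> d = 0"
    using scalar_prod_add_distrib[OF Fp BTb abcd(4)] sum0 Fp by simp
  moreover have "(F *\<^sub>v p) \<bullet> d = d \<bullet> (F *\<^sub>v p)" using comm_scalar_prod[OF Fp abcd(4)] .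
  ultimately have bA: "b \<bullet> (A *\<^sub>v p) = b \<bullet> (M *\<^sub>v p) + d \<bullet> (F *\<^sub>v p)" by linarith
  show ?thesis
  proof (cases "p = 0\<^sub>v n")
    case False
    then have "(M *\<^sub>v p) \<bullet> (P *\<^sub>v (M *\<^sub>v p)) + p \<bullet> (Q *\<^sub>v p) + (F *\<^sub>v p) \<bullet> (R *\<^sub>v (F *\<^sub>v p)) < p \<bullet> (P *\<^sub>v p)"
      using dec p unfolding lyapunov_decrease_def M_def by blast
    moreover note form_young_inv[OF P Mp abcd(2)] form_young_inv[OF R Fp abcd(4)]
      vec_young[OF abcd(3) Sp] psd_sqrt_form[OF Q p]
    ultimately show ?thesis using form bA by linarith
  next
    case True
    have a0: "a = 0\<^sub>v n" using Pp True mult_mat_zero_vec[OF P(1)] by simp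
    \<comment> \<open>On the kernel d is determined by b, so d alone cannot be the nonzero
      block.\<close>
    have "b \<noteq> 0\<^sub>v n \<or> c \<noteq> 0\<^sub>v n"
    proof (rule ccontr)
      assume bc: "\<not> ?thesis"
      then have "d = 0\<^sub>v k" using sum0 mult_mat_zero_vec[OF BT] abcd(4) by simp
      then show False using bc a0 v(2) append_vec_four_zero_iff[OF abcd] veq by simp
    qed
    moreover have "v \<bullet> (Phi n k A Q R ?Y *\<^sub>v v) = - (b \<bullet> (?Y *\<^sub>v b)) - c \<bullet> c - d \<bullet> (mat_inv R *\<^sub>v d)"
      unfolding form True mult_mat_zero_vec[OF A] mult_mat_zero_vec[OF P(1)] mult_mat_zero_vec[OF S(1)]
        scalar_prod_right_zero[OF abcd(2)] scalar_prod_right_zero[OF abcd(3)]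
        scalar_prod_right_zero[OF zero_carrier_vec] by simp
    moreover note pos_def_form_pos[OF Y pos_def_mat_inv[OF P] abcd(2)]
      pos_def_form_nonneg[OF Y pos_def_mat_inv[OF P] abcd(2)]
      pos_def_form_nonneg[OF Ri pos_def_mat_inv[OF R] abcd(4)]
      scalar_prod_self(1)[of c] scalar_prod_self_pos[OF abcd(3)]
    ultimately show ?thesis by linarith
  qed
qed

text \<open>The gain is the linear-quadratic regulator
  \<open>F = - (R + B\<^sup>T P B)\<^sup>-\<^sup>1 B\<^sup>T P A\<close>. With \<open>x = (A + B F) p\<close> its stationarity condition
  \<open>R F p = - B\<^sup>T P x\<close> puts \<open>(P p, P x, \<surd>Q p, R F p)\<close> into the kernel of \<open>B_hat\<close>.\<close>

lemma Phi_neg_imp_lyapunov_decrease: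
  assumes neg: "\<And>v. \<lbrakk>v \<in> carrier_vec ((n + n) + (n + k)); B_hat n k B *\<^sub>v v = 0\<^sub>v k;
      v \<noteq> 0\<^sub>v ((n + n) + (n + k))\<rbrakk> \<Longrightarrow> v \<bullet> (Phi n k A Q R (mat_inv P) *\<^sub>v v) < 0"
  shows "\<exists>F\<in>carrier_mat k n. lyapunov_decrease n A B Q R P F"
proof -
  let ?Y = "mat_inv P"
  note S = psd_sqrt[OF Q]
  have BT: "B\<^sup>T \<in> carrier_mat k n" using B by simp
  have TR: "R\<^sup>T = R" and TP: "P\<^sup>T = P" using R P by (auto simp: pos_def_def)
  \<comment> \<open>Half the Hessian in u of u . R u + (A p + B u) . P (A p + B u); it is positive
    definite because R is, hence invertible.\<close>
  define G where "G = R + B\<^sup>T * (P * B)"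
  have PB: "P * B \<in> carrier_mat n k" using P B by simp
  have BPB: "B\<^sup>T * (P * B) \<in> carrier_mat k k" using BT PB by (rule mult_carrier_mat)
  have G: "G \<in> carrier_mat k k" using R BPB by (simp add: G_def)
  have Gvec: "G *\<^sub>v w = R *\<^sub>v w + B\<^sup>T *\<^sub>v (P *\<^sub>v (B *\<^sub>v w))" if "w \<in> carrier_vec k" for w
    unfolding G_def add_mult_distrib_mat_vec[OF R(1) BPB that] assoc_mult_mat_vec[OF BT PB that]
      assoc_mult_mat_vec[OF P(1) B that] ..
  have "(B\<^sup>T * (P * B))\<^sup>T = B\<^sup>T * (P * B)"
    using transpose_mult[OF BT PB] transpose_mult[OF P(1) B] TP assoc_mult_mat[OF BT P(1) B] by simp
  then have "G\<^sup>T = G" using transpose_add[OF R(1) BPB] TR by (simp add: G_def)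
  moreover have "0 < w \<bullet> (G *\<^sub>v w)" if w: "w \<in> carrier_vec k" "w \<noteq> 0\<^sub>v k" for w
  proof -
    have Bw: "B *\<^sub>v w \<in> carrier_vec n" using B w by simp
    have PBw: "P *\<^sub>v (B *\<^sub>v w) \<in> carrier_vec n" using P Bw by simp
    have "w \<bullet> (B\<^sup>T *\<^sub>v (P *\<^sub>v (B *\<^sub>v w))) = (B *\<^sub>v w) \<bullet> (P *\<^sub>v (B *\<^sub>v w))"
      using form_transpose[OF BT w(1) PBw] comm_scalar_prod[OF PBw Bw] by simp
    then have "w \<bullet> (G *\<^sub>v w) = w \<bullet> (R *\<^sub>v w) + (B *\<^sub>v w) \<bullet> (P *\<^sub>v (B *\<^sub>v w))"
      unfolding Gvec[OF w(1)]
      using scalar_prod_add_distrib[OF w(1) mult_mat_vec_carrier[OF R(1) w(1)]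
          mult_mat_vec_carrier[OF BT PBw]] by simp
    then show ?thesis using pos_def_form_pos[OF R w] pos_def_form_nonneg[OF P Bw] by linarith
  qed
  ultimately have Gpd: "pos_def G" unfolding pos_def_def using carrier_matD(1)[OF G] by simp
  note Gi = mat_inv_pos_def(1)[OF G Gpd]
  define F where "F = - (mat_inv G * (B\<^sup>T * (P * A)))"
  have PA: "P * A \<in> carrier_mat n n" using P A by simp
  have BPA: "B\<^sup>T * (P * A) \<in> carrier_mat k n" using BT PA by (rule mult_carrier_mat)
  have GBPA: "mat_inv G * (B\<^sup>T * (P * A)) \<in> carrier_mat k n" using Gi BPA by (rule mult_carrier_mat)
  have F: "F \<in> carrier_mat k n" using GBPA by (simp add: F_def)
  have "lyapunov_decrease n A B Q R P F"
    unfolding lyapunov_decrease_def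
  proof (intro ballI impI)
    fix p :: "real vec" assume p: "p \<in> carrier_vec n" "p \<noteq> 0\<^sub>v n"
    define u where "u = F *\<^sub>v p"
    define x where "x = (A + B * F) *\<^sub>v p"
    define a where "a = P *\<^sub>v p"
    define b where "b = P *\<^sub>v x"
    define c where "c = psd_sqrt Q *\<^sub>v p"
    define d where "d = R *\<^sub>v u"
    have u: "u \<in> carrier_vec k" using F p by (simp add: u_def)
    have Ap: "A *\<^sub>v p \<in> carrier_vec n" using A p by simp
    have Bu: "B *\<^sub>v u \<in> carrier_vec n" using B u by simp
    have xeq: "x = A *\<^sub>v p + B *\<^sub>v u" unfolding x_def u_def by (rule closed_loop_mult_vec[OF F p(1)])
    have x: "x \<in> carrier_vec n" using xeq Ap Bu by simp
    have abcd: "a \<in> carrier_vec n" "b \<in> carrier_vec n" "c \<in> carrier_vec n" "d \<in> carrier_vec k"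
      using P p x S(1) R u by (auto simp: a_def b_def c_def d_def)
    have BTb: "B\<^sup>T *\<^sub>v b \<in> carrier_vec k" using BT abcd(2) by simp
    let ?g = "B\<^sup>T *\<^sub>v (P *\<^sub>v (A *\<^sub>v p))"
    have PAp: "P *\<^sub>v (A *\<^sub>v p) \<in> carrier_vec n" and PBu: "P *\<^sub>v (B *\<^sub>v u) \<in> carrier_vec n"
      using P Ap Bu by auto
    have g: "?g \<in> carrier_vec k" using BT PAp by simp
    have h: "B\<^sup>T *\<^sub>v (P *\<^sub>v (B *\<^sub>v u)) \<in> carrier_vec k" using BT PBu by simp
    have "u = - (mat_inv G *\<^sub>v ?g)"
    proof -
      have "(mat_inv G * (B\<^sup>T * (P * A))) *\<^sub>v p = mat_inv G *\<^sub>v ?g"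
        unfolding assoc_mult_mat_vec[OF Gi BPA p(1)] assoc_mult_mat_vec[OF BT PA p(1)]
          assoc_mult_mat_vec[OF P(1) A p(1)] ..
      moreover have "(- (mat_inv G * (B\<^sup>T * (P * A)))) *\<^sub>v p = - ((mat_inv G * (B\<^sup>T * (P * A))) *\<^sub>v p)"
        by (rule uminus_mult_mat_vec) (unfold carrier_matD(2)[OF GBPA] carrier_vecD[OF p(1)], rule refl)
      ultimately show ?thesis unfolding u_def F_def by simp
    qed
    then have "G *\<^sub>v u = - (G *\<^sub>v (mat_inv G *\<^sub>v ?g))"
      using mult_mat_vec[OF G mult_mat_vec_carrier[OF Gi g], of "- 1"]
        mult_mat_vec_carrier[OF G mult_mat_vec_carrier[OF Gi g]] mult_mat_vec_carrier[OF Gi g]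
      by (simp add: uminus_vec_eq_smult)
    then have Gu: "R *\<^sub>v u + B\<^sup>T *\<^sub>v (P *\<^sub>v (B *\<^sub>v u)) = - ?g"
      using mat_inv_mult_vec(1)[OF G Gpd g] Gvec[OF u] by simp
    have "b = P *\<^sub>v (A *\<^sub>v p) + P *\<^sub>v (B *\<^sub>v u)"
      unfolding b_def xeq by (rule mult_add_distrib_mat_vec[OF P(1) Ap Bu])
    then have "B\<^sup>T *\<^sub>v b = ?g + B\<^sup>T *\<^sub>v (P *\<^sub>v (B *\<^sub>v u))"
      using mult_add_distrib_mat_vec[OF BT PAp PBu] by simp
    moreover have "v1 + v2 + v3 = v3 + v2 + v1"
      if "v1 \<in> carrier_vec k" "v2 \<in> carrier_vec k" "v3 \<in> carrier_vec k" for v1 v2 v3 :: "real vec"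
      using that by (intro eq_vecI) auto
    ultimately have "B\<^sup>T *\<^sub>v b + d = (R *\<^sub>v u + B\<^sup>T *\<^sub>v (P *\<^sub>v (B *\<^sub>v u))) + ?g"
      using g h abcd(4) unfolding d_def by metis
    also have "\<dots> = 0\<^sub>v k" unfolding Gu using g by simp
    finally have sum0: "B\<^sup>T *\<^sub>v b + d = 0\<^sub>v k" .
    \<comment> \<open>This vector attains equality in all three Young inequalities of the opposite
      direction, so the form of \<open>Phi\<close> at it equals the Lyapunov difference at
      p.\<close>
    let ?v = "(a @\<^sub>v b) @\<^sub>v (c @\<^sub>v d)"
    have "a \<noteq> 0\<^sub>v n"
    proof
      assume "a = 0\<^sub>v n"
      then show False using pos_def_form_pos[OF P p] p(1) by (simp add: a_def)
    qed
    then have "?v \<noteq> 0\<^sub>v ((n + n) + (n + k))" using append_vec_four_zero_iff[OF abcd] by blast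
    moreover have "?v \<in> carrier_vec ((n + n) + (n + k))" using abcd by (intro append_carrier_vec)
    moreover have "B_hat n k B *\<^sub>v ?v = 0\<^sub>v k" using B_hat_mult_vec(2)[OF B abcd] sum0 by simp
    ultimately have "?v \<bullet> (Phi n k A Q R ?Y *\<^sub>v ?v) < 0" using neg by blast
    moreover have Ya: "?Y *\<^sub>v a = p" and Yb: "?Y *\<^sub>v b = x" and Rd: "mat_inv R *\<^sub>v d = u"
      unfolding a_def b_def d_def
      using mat_inv_mult_vec(2)[OF P p(1)] mat_inv_mult_vec(2)[OF P x] mat_inv_mult_vec(2)[OF R u]
      by auto
    ultimately have "- (a \<bullet> p) - b \<bullet> x - c \<bullet> c - d \<bullet> u + 2 * (b \<bullet> (A *\<^sub>v p)) + 2 * (c \<bullet> c) < 0"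
      unfolding Phi_form[OF abcd] Ya Yb Rd c_def[symmetric] by simp
    moreover have "b \<bullet> x = b \<bullet> (A *\<^sub>v p) + b \<bullet> (B *\<^sub>v u)"
      unfolding xeq using scalar_prod_add_distrib[OF abcd(2) Ap Bu] .
    moreover have "b \<bullet> (B *\<^sub>v u) = u \<bullet> (B\<^sup>T *\<^sub>v b)" using form_transpose[OF B abcd(2) u] .
    moreover have "u \<bullet> (B\<^sup>T *\<^sub>v b) + u \<bullet> d = 0"
      using scalar_prod_add_distrib[OF u BTb abcd(4)] sum0 u by simp
    moreover have "u \<bullet> d = d \<bullet> u" "d \<bullet> u = u \<bullet> (R *\<^sub>v u)" "b \<bullet> x = x \<bullet> (P *\<^sub>v x)" "a \<bullet> p = p \<bullet> (P *\<^sub>v p)"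
      using comm_scalar_prod[OF u abcd(4)] comm_scalar_prod[OF abcd(2) x]
        comm_scalar_prod[OF abcd(1) p(1)] unfolding a_def b_def d_def by auto
    moreover have "c \<bullet> c = p \<bullet> (Q *\<^sub>v p)" unfolding c_def by (rule psd_sqrt_form[OF Q p(1)])
    ultimately have "x \<bullet> (P *\<^sub>v x) + p \<bullet> (Q *\<^sub>v p) + u \<bullet> (R *\<^sub>v u) < p \<bullet> (P *\<^sub>v p)" by linarith
    then show "((A + B * F) *\<^sub>v p) \<bullet> (P *\<^sub>v ((A + B * F) *\<^sub>v p))
      + p \<bullet> (Q *\<^sub>v p) + (F *\<^sub>v p) \<bullet> (R *\<^sub>v (F *\<^sub>v p)) < p \<bullet> (P *\<^sub>v p)"
      unfolding x_def u_def .
  qed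
  then show ?thesis using F by blast
qed

end

section \<open>Worst-case cost over a ball of initial states\<close>

lemma stage_cost:
  fixes Q R F :: "real mat"
  assumes "Q \<in> carrier_mat n n" "R \<in> carrier_mat k k" "F \<in> carrier_mat k n" "x \<in> carrier_vec n"
  shows "x \<bullet> ((Q + F\<^sup>T * R * F) *\<^sub>v x) = x \<bullet> (Q *\<^sub>v x) + (F *\<^sub>v x) \<bullet> (R *\<^sub>v (F *\<^sub>v x))"
proof -
  have Fx: "F *\<^sub>v x \<in> carrier_vec k" using assms(3,4) by simp
  have RFx: "R *\<^sub>v (F *\<^sub>v x) \<in> carrier_vec k" using assms(2) Fx by simp
  have FT: "F\<^sup>T \<in> carrier_mat n k" using assms(3) by simp
  have FR: "F\<^sup>T * R \<in> carrier_mat n k" using FT assms(2) by simp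
  have FRF: "F\<^sup>T * R * F \<in> carrier_mat n n" using FR assms(3) by simp
  have "(F\<^sup>T * R * F) *\<^sub>v x = F\<^sup>T *\<^sub>v (R *\<^sub>v (F *\<^sub>v x))"
    unfolding assoc_mult_mat_vec[OF FR assms(3,4)] assoc_mult_mat_vec[OF FT assms(2) Fx] ..
  moreover have "x \<bullet> (F\<^sup>T *\<^sub>v (R *\<^sub>v (F *\<^sub>v x))) = (F *\<^sub>v x) \<bullet> (R *\<^sub>v (F *\<^sub>v x))"
    using form_transpose[OF FT assms(4) RFx] comm_scalar_prod[OF RFx Fx] by simp
  ultimately show ?thesis
    using add_mult_distrib_mat_vec[OF assms(1) FRF assms(4)]
      scalar_prod_add_distrib[OF assms(4), of "Q *\<^sub>v x" "(F\<^sup>T * R * F) *\<^sub>v x"]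
      mult_mat_vec_carrier[OF assms(1,4)] mult_mat_vec_carrier[OF FRF assms(4)] by simp
qed

lemma pos_semidef_stage_cost:
  assumes Q: "Q \<in> carrier_mat n n" "pos_semidef Q" and R: "R \<in> carrier_mat k k" "pos_def R"
    and F: "F \<in> carrier_mat k n"
  shows "Q + F\<^sup>T * R * F \<in> carrier_mat n n" "pos_semidef (Q + F\<^sup>T * R * F)"
proof -
  have FT: "F\<^sup>T \<in> carrier_mat n k" using F by simp
  have FR: "F\<^sup>T * R \<in> carrier_mat n k" using mult_carrier_mat[OF FT R(1)] .
  have FRF: "F\<^sup>T * R * F \<in> carrier_mat n n" using mult_carrier_mat[OF FR F] .
  have T: "Q\<^sup>T = Q" "R\<^sup>T = R" using Q R by (auto simp: pos_semidef_def pos_def_def)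
  show W: "Q + F\<^sup>T * R * F \<in> carrier_mat n n" using FRF by simp
  have "(F\<^sup>T * R)\<^sup>T = R * F" using transpose_mult[OF FT R(1)] T by simp
  then have "(F\<^sup>T * R * F)\<^sup>T = F\<^sup>T * R * F"
    using transpose_mult[OF FR F] assoc_mult_mat[OF FT R(1) F] by simp
  then have "(Q + F\<^sup>T * R * F)\<^sup>T = Q + F\<^sup>T * R * F"
    using transpose_add[OF Q(1) FRF] T by simp
  moreover have "0 \<le> x \<bullet> ((Q + F\<^sup>T * R * F) *\<^sub>v x)" if x: "x \<in> carrier_vec n" for x
  proof -
    have "0 \<le> x \<bullet> (Q *\<^sub>v x)" using Q x by (auto simp: pos_semidef_def)
    moreover have "0 \<le> (F *\<^sub>v x) \<bullet> (R *\<^sub>v (F *\<^sub>v x))"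
      using pos_def_imp_semidef[OF R] R(1) mult_mat_vec_carrier[OF F x]
      by (auto simp: pos_semidef_def)
    ultimately show ?thesis using stage_cost[OF Q(1) R(1) F x] by simp
  qed
  ultimately show "pos_semidef (Q + F\<^sup>T * R * F)"
    using carrier_matD(1)[OF W] by (simp add: pos_semidef_def)
qed

text \<open>The supremum from \<open>guaranteed_response\<close> with closed loop M and stage weight
  W as plain matrices, so that the estimates are independent of the game.\<close>

definition worst_cost :: "nat \<Rightarrow> real \<Rightarrow> real mat \<Rightarrow> real mat \<Rightarrow> ereal" where
  "worst_cost n r M W =
    (SUP x0 \<in> initial_states n r. \<Sum>k. ereal (trajectory M x0 k \<bullet> (W *\<^sub>v trajectory M x0 k)))"

lemma initial_states_iff:
  assumes "r > 0"
  shows "x \<in> initial_states n r \<longleftrightarrow> x \<in> carrier_vec n \<and> x \<bullet> x < r\<^sup>2"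
proof -
  have "sqrt (x \<bullet> x) < r \<longleftrightarrow> x \<bullet> x < r\<^sup>2"
    using assms real_sqrt_less_iff[of "x \<bullet> x" "r\<^sup>2"] by simp
  then show ?thesis by (auto simp: initial_states_def)
qed

text \<open>The identity weight adds a multiple of the solution of a second Lyapunov equation,
  which makes both inequalities strict.\<close>

lemma worst_cost_less_imp_lyapunov:
  assumes M: "M \<in> carrier_mat n n" and stable: "schur_stable M"
    and W: "W \<in> carrier_mat n n" "pos_semidef W"
    and r: "r > 0" and \<delta>: "\<delta> > 0" and less: "worst_cost n r M W < ereal \<delta>"
  shows "\<exists>P\<in>carrier_mat n n. pos_def P
    \<and> (\<forall>x\<in>carrier_vec n. x \<noteq> 0\<^sub>v n
        \<longrightarrow> (M *\<^sub>v x) \<bullet> (P *\<^sub>v (M *\<^sub>v x)) + x \<bullet> (W *\<^sub>v x) < x \<bullet> (P *\<^sub>v x))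
    \<and> (\<forall>x\<in>carrier_vec n. x \<noteq> 0\<^sub>v n \<longrightarrow> r\<^sup>2 / \<delta> * (x \<bullet> (P *\<^sub>v x)) < x \<bullet> x)"
proof -
  have WT: "W\<^sup>T = W" and W0: "\<And>x. x \<in> carrier_vec n \<Longrightarrow> 0 \<le> x \<bullet> (W *\<^sub>v x)"
    using W carrier_matD(1)[OF W(1)] by (auto simp: pos_semidef_def)
  obtain P1 where P1: "P1 \<in> carrier_mat n n" "P1\<^sup>T = P1"
    and s1: "\<And>x. x \<in> carrier_vec n \<Longrightarrow>
      (\<lambda>k. trajectory M x k \<bullet> (W *\<^sub>v trajectory M x k)) sums (x \<bullet> (P1 *\<^sub>v x))"
    using lyapunov_solution[OF M stable W(1) WT] by blast
  obtain P2 where P2: "P2 \<in> carrier_mat n n" "P2\<^sup>T = P2"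
    and s2: "\<And>x. x \<in> carrier_vec n \<Longrightarrow>
      (\<lambda>k. trajectory M x k \<bullet> (1\<^sub>m n *\<^sub>v trajectory M x k)) sums (x \<bullet> (P2 *\<^sub>v x))"
    using lyapunov_solution[OF M stable one_carrier_mat transpose_one] by blast
  have P1_nonneg: "0 \<le> x \<bullet> (P1 *\<^sub>v x)" if "x \<in> carrier_vec n" for x
    using sums_le[OF _ sums_zero s1[OF that]] W0 trajectory_carrier[OF M that] by blast
  have one: "1\<^sub>m n *\<^sub>v trajectory M x k = trajectory M x k" if "x \<in> carrier_vec n" for x k
    using trajectory_carrier[OF M that] by simp
  have P2_nonneg: "0 \<le> x \<bullet> (P2 *\<^sub>v x)" if "x \<in> carrier_vec n" for x
    using sums_le[OF _ sums_zero s2[OF that]] scalar_prod_self(1) one[OF that] by simp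
  note l1 = lyapunov_equation[OF M _ s1]
  have l2: "x \<bullet> (P2 *\<^sub>v x) = (M *\<^sub>v x) \<bullet> (P2 *\<^sub>v (M *\<^sub>v x)) + x \<bullet> x" if "x \<in> carrier_vec n" for x
    using lyapunov_equation[OF M that s2] that by simp
  have P2_pos: "0 < x \<bullet> (P2 *\<^sub>v x)" if "x \<in> carrier_vec n" "x \<noteq> 0\<^sub>v n" for x
    using l2[OF that(1)] P2_nonneg[OF mult_mat_vec_carrier[OF M that(1)]] scalar_prod_self_pos[OF that]
    by linarith
  \<comment> \<open>A real bound below \<open>\<delta>\<close> that is uniform over the ball; the
    gap between s and \<open>\<delta>\<close> is spent below.\<close>
  obtain s where s: "worst_cost n r M W < ereal s" "s < \<delta>"
    using ereal_dense2[OF less] by auto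
  have ball: "x \<bullet> (P1 *\<^sub>v x) < s" if x: "x \<in> carrier_vec n" "x \<bullet> x < r\<^sup>2" for x
  proof -
    have "x \<in> initial_states n r" using initial_states_iff[OF r] x by blast
    then have "(\<Sum>k. ereal (trajectory M x k \<bullet> (W *\<^sub>v trajectory M x k))) \<le> worst_cost n r M W"
      unfolding worst_cost_def by (rule SUP_upper)
    moreover have "(\<lambda>k. ereal (trajectory M x k \<bullet> (W *\<^sub>v trajectory M x k))) sums ereal (x \<bullet> (P1 *\<^sub>v x))"
      using s1[OF x(1)] by (simp add: sums_ereal)
    ultimately have "ereal (x \<bullet> (P1 *\<^sub>v x)) \<le> worst_cost n r M W" by (simp add: sums_iff)
    then have "ereal (x \<bullet> (P1 *\<^sub>v x)) < ereal s" using s(1) by (rule le_less_trans)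
    then show ?thesis by simp
  qed
  \<comment> \<open>The zero state lies in the ball and costs nothing, which forces s > 0.\<close>
  have "0\<^sub>v n \<bullet> (P1 *\<^sub>v 0\<^sub>v n) < s" using ball[of "0\<^sub>v n"] r by simp
  then have s0: "0 < s" using mult_mat_vec_carrier[OF P1(1) zero_carrier_vec] by simp
  \<comment> \<open>Half of the gap, from s to q, keeps rescaled states strictly inside the open
    ball; the other half, from q to \<open>\<delta>\<close>, pays for the perturbation of
    P1.\<close>
  define q where "q = (s + \<delta>) / 2"
  have q: "s < q" "q < \<delta>" "0 < q" using s(2) s0 by (auto simp: q_def)
  have P1_le: "x \<bullet> (P1 *\<^sub>v x) \<le> q / r\<^sup>2 * (x \<bullet> x)" if x: "x \<in> carrier_vec n" "x \<noteq> 0\<^sub>v n" for x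
  proof -
    have xx: "0 < x \<bullet> x" using scalar_prod_self_pos[OF x] .
    \<comment> \<open>The scaling for which t x has squared length r^2 s / q, just inside the ball;
      homogeneity then turns the bound s there into a bound on P1 everywhere.\<close>
    define t where "t = sqrt (s * r\<^sup>2 / (q * (x \<bullet> x)))"
    have t2: "t\<^sup>2 = s * r\<^sup>2 / (q * (x \<bullet> x))" using s0 q xx by (simp add: t_def)
    have "(t \<cdot>\<^sub>v x) \<bullet> (t \<cdot>\<^sub>v x) = t\<^sup>2 * (x \<bullet> x)" using x by (simp add: power2_eq_square)
    also have "\<dots> = r\<^sup>2 * (s / q)" unfolding t2 using xx by simp
    also have "\<dots> < r\<^sup>2 * 1" using q s0 r by (intro mult_strict_left_mono) auto
    finally have "(t \<cdot>\<^sub>v x) \<bullet> (P1 *\<^sub>v (t \<cdot>\<^sub>v x)) < s" using ball[of "t \<cdot>\<^sub>v x"] x by simp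
    also have "(t \<cdot>\<^sub>v x) \<bullet> (P1 *\<^sub>v (t \<cdot>\<^sub>v x)) = t\<^sup>2 * (x \<bullet> (P1 *\<^sub>v x))"
      using x mult_mat_vec[OF P1(1) x(1), of t] mult_mat_vec_carrier[OF P1(1) x(1)]
      by (simp add: power2_eq_square)
    finally have "s * (r\<^sup>2 * (x \<bullet> (P1 *\<^sub>v x))) < s * (q * (x \<bullet> x))"
      unfolding t2 using q xx by (simp add: field_simps)
    then have "r\<^sup>2 * (x \<bullet> (P1 *\<^sub>v x)) < q * (x \<bullet> x)" using s0 by simp
    then show ?thesis using r by (simp add: field_simps)
  qed
  obtain C where C: "C > 0" "\<And>x. x \<in> carrier_vec n \<Longrightarrow> x \<bullet> (P2 *\<^sub>v x) \<le> C * (x \<bullet> x)"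
    using form_bounded[OF P2(1)] by blast
  \<comment> \<open>Chosen so that \<open>\<epsilon>\<close> C is half of (\<open>\<delta>\<close> -
    q) / r^2: P is then at most (\<open>\<delta>\<close> + q) / (2 r^2) times the identity, still
    strictly below \<open>\<delta>\<close> / r^2.\<close>
  define \<epsilon> where "\<epsilon> = (\<delta> - q) / (2 * r\<^sup>2 * C)"
  have \<epsilon>: "\<epsilon> > 0" using q r C(1) by (simp add: \<epsilon>_def)
  define P where "P = P1 + \<epsilon> \<cdot>\<^sub>m P2"
  have eP2: "\<epsilon> \<cdot>\<^sub>m P2 \<in> carrier_mat n n" using P2 by simp
  have P: "P \<in> carrier_mat n n" using P1 P2 by (simp add: P_def)
  have PT: "P\<^sup>T = P"
    using transpose_add[OF P1(1) eP2] P1(2) P2(2) by (simp add: P_def smult_transpose_mat)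
  have form: "x \<bullet> (P *\<^sub>v x) = x \<bullet> (P1 *\<^sub>v x) + \<epsilon> * (x \<bullet> (P2 *\<^sub>v x))" if "x \<in> carrier_vec n" for x
    unfolding P_def add_mult_distrib_mat_vec[OF P1(1) eP2 that] smult_mult_mat_vec[OF P2(1) that]
    using that mult_mat_vec_carrier[OF P1(1) that] mult_mat_vec_carrier[OF P2(1) that]
    by (simp add: scalar_prod_add_distrib[of _ n])
  have "pos_def P"
    unfolding pos_def_def carrier_matD[OF P]
    using PT form P1_nonneg P2_pos \<epsilon> by (simp add: add_nonneg_pos)
  moreover have "(M *\<^sub>v x) \<bullet> (P *\<^sub>v (M *\<^sub>v x)) + x \<bullet> (W *\<^sub>v x) < x \<bullet> (P *\<^sub>v x)"
    if x: "x \<in> carrier_vec n" "x \<noteq> 0\<^sub>v n" for x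
  proof -
    have "0 < \<epsilon> * (x \<bullet> x)" using \<epsilon> scalar_prod_self_pos[OF x] by simp
    then show ?thesis
      unfolding form[OF x(1)] form[OF mult_mat_vec_carrier[OF M x(1)]] l2[OF x(1)]
      using l1[OF x(1)] by (simp add: algebra_simps)
  qed
  moreover have "r\<^sup>2 / \<delta> * (x \<bullet> (P *\<^sub>v x)) < x \<bullet> x" if x: "x \<in> carrier_vec n" "x \<noteq> 0\<^sub>v n" for x
  proof -
    have xx: "0 < x \<bullet> x" using scalar_prod_self_pos[OF x] .
    have "\<epsilon> * (x \<bullet> (P2 *\<^sub>v x)) \<le> \<epsilon> * (C * (x \<bullet> x))"
      using C(2)[OF x(1)] \<epsilon> by (intro mult_left_mono) auto
    also have "\<dots> = (\<delta> - q) / (2 * r\<^sup>2) * (x \<bullet> x)" using C(1) by (simp add: \<epsilon>_def)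
    finally have "x \<bullet> (P *\<^sub>v x) \<le> (q / r\<^sup>2 + (\<delta> - q) / (2 * r\<^sup>2)) * (x \<bullet> x)"
      using P1_le[OF x] form[OF x(1)] by (simp add: algebra_simps)
    also have "q / r\<^sup>2 + (\<delta> - q) / (2 * r\<^sup>2) = (\<delta> + q) / (2 * r\<^sup>2)" using r by (simp add: field_simps)
    also have "\<dots> * (x \<bullet> x) < \<delta> / r\<^sup>2 * (x \<bullet> x)"
      using q(2) r xx by (intro mult_strict_right_mono) (auto simp: field_simps)
    finally have "r\<^sup>2 / \<delta> * (x \<bullet> (P *\<^sub>v x)) < r\<^sup>2 / \<delta> * (\<delta> / r\<^sup>2 * (x \<bullet> x))"
      using r \<delta> by (intro mult_strict_left_mono) auto
    then show ?thesis using r \<delta> by simp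
  qed
  ultimately show ?thesis using P by blast
qed

text \<open>Pointwise strictness does not survive the supremum over the ball. The matrix D = 1 -
  (r^2 / \<open>\<delta>\<close>) P is positive definite, hence bounded below by a multiple of the
  identity, and this margin holds every cost below a fixed fraction of
  \<open>\<delta>\<close>.\<close>

lemma lyapunov_imp_worst_cost_less:
  assumes M: "M \<in> carrier_mat n n" and W: "W \<in> carrier_mat n n" "pos_semidef W"
    and P: "P \<in> carrier_mat n n" "pos_def P" and r: "r > 0" and \<delta>: "\<delta> > 0"
    and dec: "\<And>x. x \<in> carrier_vec n \<Longrightarrow> x \<noteq> 0\<^sub>v n
      \<Longrightarrow> (M *\<^sub>v x) \<bullet> (P *\<^sub>v (M *\<^sub>v x)) + x \<bullet> (W *\<^sub>v x) < x \<bullet> (P *\<^sub>v x)"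
    and bound: "\<And>x. x \<in> carrier_vec n \<Longrightarrow> x \<noteq> 0\<^sub>v n \<Longrightarrow> r\<^sup>2 / \<delta> * (x \<bullet> (P *\<^sub>v x)) < x \<bullet> x"
  shows "worst_cost n r M W < ereal \<delta>"
proof -
  define D where "D = 1\<^sub>m n - (r\<^sup>2 / \<delta>) \<cdot>\<^sub>m P"
  have sP: "(r\<^sup>2 / \<delta>) \<cdot>\<^sub>m P \<in> carrier_mat n n" using P by simp
  have D: "D \<in> carrier_mat n n" using sP by (simp add: D_def minus_carrier_mat)
  have form: "x \<bullet> (D *\<^sub>v x) = x \<bullet> x - r\<^sup>2 / \<delta> * (x \<bullet> (P *\<^sub>v x))" if x: "x \<in> carrier_vec n" for x
    unfolding D_def minus_mult_distrib_mat_vec[OF one_carrier_mat sP x] smult_mult_mat_vec[OF P(1) x]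
    using x mult_mat_vec_carrier[OF P(1) x] by (simp add: scalar_prod_minus_distrib[of _ n])
  have "D\<^sup>T = D"
    using transpose_minus[OF one_carrier_mat sP] P(2)
    by (simp add: D_def smult_transpose_mat pos_def_def)
  then have "pos_def D" unfolding pos_def_def carrier_matD[OF D] using form bound by simp
  then obtain \<epsilon> where \<epsilon>: "\<epsilon> > 0" "\<And>x. x \<in> carrier_vec n \<Longrightarrow> \<epsilon> * (x \<bullet> x) \<le> x \<bullet> (D *\<^sub>v x)"
    using pos_def_bounded_below[OF D] by blast
  \<comment> \<open>The cap at 1 keeps the factor 1 - \<open>\<eta>\<close> nonnegative, so that the
    bound x . x < r^2 may be multiplied by it.\<close>
  define \<eta> where "\<eta> = min \<epsilon> 1"
  have \<eta>: "0 < \<eta>" "\<eta> \<le> \<epsilon>" "\<eta> \<le> 1" using \<epsilon> by (auto simp: \<eta>_def)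
  have dec': "(M *\<^sub>v x) \<bullet> (P *\<^sub>v (M *\<^sub>v x)) + x \<bullet> (W *\<^sub>v x) \<le> x \<bullet> (P *\<^sub>v x)" if "x \<in> carrier_vec n" for x
    using dec[OF that] mult_mat_zero_vec[OF M] mult_mat_zero_vec[OF P(1)] mult_mat_zero_vec[OF W(1)]
    by (cases "x = 0\<^sub>v n") force+
  have "worst_cost n r M W \<le> ereal ((1 - \<eta>) * \<delta>)"
    unfolding worst_cost_def
  proof (rule SUP_least)
    fix x assume "x \<in> initial_states n r"
    then have x: "x \<in> carrier_vec n" "x \<bullet> x < r\<^sup>2" using initial_states_iff[OF r] by blast+
    have "\<eta> * (x \<bullet> x) \<le> \<epsilon> * (x \<bullet> x)" using \<eta>(2) scalar_prod_self(1) by (rule mult_right_mono)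
    then have "r\<^sup>2 / \<delta> * (x \<bullet> (P *\<^sub>v x)) \<le> (1 - \<eta>) * (x \<bullet> x)"
      using \<epsilon>(2)[OF x(1)] form[OF x(1)] by (simp add: algebra_simps)
    also have "\<dots> \<le> (1 - \<eta>) * r\<^sup>2" using x(2) \<eta>(3) by (intro mult_left_mono) auto
    finally have "r\<^sup>2 * (x \<bullet> (P *\<^sub>v x)) \<le> r\<^sup>2 * ((1 - \<eta>) * \<delta>)" using \<delta> by (simp add: field_simps)
    then have "x \<bullet> (P *\<^sub>v x) \<le> (1 - \<eta>) * \<delta>" using r by simp
    then show "(\<Sum>k. ereal (trajectory M x k \<bullet> (W *\<^sub>v trajectory M x k))) \<le> ereal ((1 - \<eta>) * \<delta>)"
      using trajectory_cost_le[OF M P(1) pos_def_imp_semidef[OF P] W x(1) dec']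
      by (meson ereal_less_eq(3) order_trans)
  qed
  also have "ereal ((1 - \<eta>) * \<delta>) < ereal \<delta>" using \<eta>(1) \<delta> by simp
  finally show ?thesis .
qed

section \<open>From the game to the closed loop of one player\<close>

lemma closed_loop_update:
  assumes A: "A \<in> carrier_mat n n" and i: "i \<in> {1..N}"
    and B: "B i \<in> carrier_mat n k" and Fi: "Fi \<in> carrier_mat k n"
  shows "closed_loop n N A B (F(i := Fi)) = A + input_sum n B F ({1..N} - {i}) + B i * Fi"
proof (rule eq_matI)
  fix a b
  assume "a < dim_row (A + input_sum n B F ({1..N} - {i}) + B i * Fi)"
    "b < dim_col (A + input_sum n B F ({1..N} - {i}) + B i * Fi)"
  then have ab: "a < n" "b < n" using B Fi by auto
  have "(\<Sum>j\<in>{1..N}. (B j * (F(i := Fi)) j) $$ (a, b))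
    = (B i * Fi) $$ (a, b) + (\<Sum>j\<in>{1..N} - {i}. (B j * (F(i := Fi)) j) $$ (a, b))"
    using sum.remove[OF _ i, of "\<lambda>j. (B j * (F(i := Fi)) j) $$ (a, b)"] by simp
  also have "(\<Sum>j\<in>{1..N} - {i}. (B j * (F(i := Fi)) j) $$ (a, b))
    = (\<Sum>j\<in>{1..N} - {i}. (B j * F j) $$ (a, b))"
    by (intro sum.cong) auto
  finally show "closed_loop n N A B (F(i := Fi)) $$ (a, b)
    = (A + input_sum n B F ({1..N} - {i}) + B i * Fi) $$ (a, b)"
    using ab A B Fi by (simp add: closed_loop_def input_sum_def)
qed (use A B Fi in \<open>auto simp: closed_loop_def input_sum_def\<close>)


theorem corollary1:
  fixes n N i :: nat and m :: "nat \<Rightarrow> nat"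
    and A :: "real mat" and B Q R F :: "nat \<Rightarrow> real mat"
    and r \<delta> :: real and Ai K :: "real mat"
  assumes "A \<in> carrier_mat n n"
    and "\<And>j. j \<in> {1..N} \<Longrightarrow> B j \<in> carrier_mat n (m j)"
    and "\<And>j. j \<in> {1..N} \<Longrightarrow> Q j \<in> carrier_mat n n \<and> pos_semidef (Q j)"
    and "\<And>j. j \<in> {1..N} \<Longrightarrow> R j \<in> carrier_mat (m j) (m j) \<and> pos_def (R j)"
    and "stabilizing_profiles n m N A B \<noteq> {}"
    and "i \<in> {1..N}"
    and "r > 0" and "\<delta> > 0"
    and "\<And>j. j \<in> {1..N} - {i} \<Longrightarrow> F j \<in> carrier_mat (m j) n"
    and "Ai = A + input_sum n B F ({1..N} - {i})"
    and "orthonormal_null_basis (B_hat n (m i) (B i)) K"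
  shows "(((\<exists>Fi. Fi \<in> guaranteed_response n m N A B Q R r i \<delta> F) \<and>
          (\<forall>Fi \<in> guaranteed_response n m N A B Q R r i \<delta> F. schur_stable (Ai + B i * Fi)))
         \<longleftrightarrow> P_set n (m i) Ai (Q i) (R i) r \<delta> K \<noteq> {})
       \<and> (P_set n (m i) Ai (Q i) (R i) r \<delta> K \<noteq> {} \<longrightarrow>
         (\<forall>Fi \<in> guaranteed_response n m N A B Q R r i \<delta> F.
           \<exists>P \<in> P_set n (m i) Ai (Q i) (R i) r \<delta> K.
             neg_def (block_mat4
               (- P)
                 ((Ai + B i * Fi)\<^sup>T * P)
                 ((psd_sqrt (Q i))\<^sup>T)
                 ((psd_sqrt (R i) * Fi)\<^sup>T)
               (P * (Ai + B i * Fi))   (- P)            (0\<^sub>m n n)        (0\<^sub>m n (m i))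
               (psd_sqrt (Q i))        (0\<^sub>m n n)        (- 1\<^sub>m n)        (0\<^sub>m n (m i))
               (psd_sqrt (R i) * Fi)   (0\<^sub>m (m i) n)    (0\<^sub>m (m i) n)    (- 1\<^sub>m (m i)))))"
proof -
  let ?resp = "guaranteed_response n m N A B Q R r i \<delta> F"
  let ?Ps = "P_set n (m i) Ai (Q i) (R i) r \<delta> K"
  have Ai: "Ai \<in> carrier_mat n n" using assms(1,10) by (simp add: input_sum_def)
  have Bi: "B i \<in> carrier_mat n (m i)" using assms(2,6) .
  have Qi: "Q i \<in> carrier_mat n n" "pos_semidef (Q i)" using assms(3,6) by auto
  have Ri: "R i \<in> carrier_mat (m i) (m i)" "pos_def (R i)" using assms(4,6) by auto
  have t: "r\<^sup>2 / \<delta> > 0" using assms(7,8) by simp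
  have closed: "closed_loop n N A B (F(i := Fi)) = Ai + B i * Fi" if "Fi \<in> carrier_mat (m i) n" for Fi
    unfolding assms(10) by (rule closed_loop_update[where B = B, OF assms(1,6) Bi that])
  have profile: "\<forall>j\<in>{1..N}. (F(i := Fi)) j \<in> carrier_mat (m j) n" if "Fi \<in> carrier_mat (m i) n" for Fi
    using assms(9) that by simp
  have resp_iff: "Fi \<in> ?resp \<longleftrightarrow> Fi \<in> carrier_mat (m i) n \<and> schur_stable (Ai + B i * Fi)
      \<and> worst_cost n r (Ai + B i * Fi) (Q i + Fi\<^sup>T * R i * Fi) < ereal \<delta>" for Fi
  proof (cases "Fi \<in> carrier_mat (m i) n")
    case True
    then show ?thesis
      unfolding guaranteed_response_def stabilizing_profiles_def cost_def worst_cost_def Let_def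
      using closed[OF True] profile[OF True] by (simp del: fun_upd_apply add: fun_upd_same)
  qed (simp add: guaranteed_response_def)
  \<comment> \<open>The gain is eliminated in exactly this sense: membership of P asserts that some
    gain satisfies the Lyapunov inequality with P, without naming it.\<close>
  have P_iff: "P \<in> ?Ps \<longleftrightarrow> P \<in> carrier_mat n n \<and> pos_def P
      \<and> (\<forall>x\<in>carrier_vec n. x \<noteq> 0\<^sub>v n \<longrightarrow> r\<^sup>2 / \<delta> * (x \<bullet> (P *\<^sub>v x)) < x \<bullet> x)
      \<and> (\<exists>Fi\<in>carrier_mat (m i) n. lyapunov_decrease n Ai (B i) (Q i) (R i) P Fi)" for P
  proof (cases "P \<in> carrier_mat n n \<and> pos_def P")
    case True
    then have P: "P \<in> carrier_mat n n" "pos_def P" by auto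
    \<comment> \<open>The dimension of \<open>B_hat\<close> comes from a lemma that also speaks of
      four block vectors; zero vectors discharge those premises.\<close>
    note hat = B_hat_mult_vec(1)[OF Bi zero_carrier_vec zero_carrier_vec zero_carrier_vec zero_carrier_vec]
    note Phi = Phi_carrier[OF Ai Bi Qi Ri P] Phi_symmetric[OF Ai Bi Qi Ri P]
    note lmi = orthonormal_null_basis_neg_def_iff[OF hat assms(11) Phi]
    have "neg_def (K\<^sup>T * Phi n (m i) Ai (Q i) (R i) (mat_inv P) * K)
      \<longleftrightarrow> (\<exists>Fi\<in>carrier_mat (m i) n. lyapunov_decrease n Ai (B i) (Q i) (R i) P Fi)"
      unfolding lmi
      using Phi_neg_imp_lyapunov_decrease[OF Ai Bi Qi Ri P]
        lyapunov_decrease_imp_Phi_neg[OF Ai Bi Qi Ri P] by blast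
    then show ?thesis
      unfolding P_set_def Y_set_def
      using P pos_def_mat_inv[OF P] mat_inv_pos_def(1)[OF P]
        pos_def_minus_smult_one_iff_inv[OF P t] by simp
  qed (auto simp: P_set_def)
  have decrease: "(M *\<^sub>v x) \<bullet> (P *\<^sub>v (M *\<^sub>v x)) + x \<bullet> ((Q i + Fi\<^sup>T * R i * Fi) *\<^sub>v x) < x \<bullet> (P *\<^sub>v x)
      \<longleftrightarrow> (M *\<^sub>v x) \<bullet> (P *\<^sub>v (M *\<^sub>v x)) + x \<bullet> (Q i *\<^sub>v x) + (Fi *\<^sub>v x) \<bullet> (R i *\<^sub>v (Fi *\<^sub>v x)) < x \<bullet> (P *\<^sub>v x)"
    if "Fi \<in> carrier_mat (m i) n" "x \<in> carrier_vec n" for M P Fi x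
    unfolding stage_cost[OF Qi(1) Ri(1) that] by (simp only: add.assoc)
  \<comment> \<open>More than nonemptiness: the matrix P found here works for the given response
    itself, and this is what the block inequality of the last claim needs.\<close>
  have response: "\<exists>P\<in>?Ps. lyapunov_decrease n Ai (B i) (Q i) (R i) P Fi" if "Fi \<in> ?resp" for Fi
  proof -
    have Fi: "Fi \<in> carrier_mat (m i) n" and stable: "schur_stable (Ai + B i * Fi)"
      and less: "worst_cost n r (Ai + B i * Fi) (Q i + Fi\<^sup>T * R i * Fi) < ereal \<delta>"
      using that resp_iff by auto
    have M: "Ai + B i * Fi \<in> carrier_mat n n" using Ai Bi Fi by simp
    obtain P where P: "P \<in> carrier_mat n n" "pos_def P"
      and dec: "\<forall>x\<in>carrier_vec n. x \<noteq> 0\<^sub>v n \<longrightarrow>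
        ((Ai + B i * Fi) *\<^sub>v x) \<bullet> (P *\<^sub>v ((Ai + B i * Fi) *\<^sub>v x))
          + x \<bullet> ((Q i + Fi\<^sup>T * R i * Fi) *\<^sub>v x) < x \<bullet> (P *\<^sub>v x)"
      and bound: "\<forall>x\<in>carrier_vec n. x \<noteq> 0\<^sub>v n \<longrightarrow> r\<^sup>2 / \<delta> * (x \<bullet> (P *\<^sub>v x)) < x \<bullet> x"
      using worst_cost_less_imp_lyapunov[OF M stable pos_semidef_stage_cost[OF Qi Ri Fi]
          assms(7,8) less] by (elim bexE conjE)
    have "lyapunov_decrease n Ai (B i) (Q i) (R i) P Fi"
      unfolding lyapunov_decrease_def using dec decrease[OF Fi] by simp
    moreover from this have "P \<in> ?Ps" unfolding P_iff using P bound Fi by (intro conjI bexI)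
    ultimately show ?thesis by (rule bexI)
  qed
  have "\<exists>Fi. Fi \<in> ?resp" if nonempty: "?Ps \<noteq> {}"
  proof -
    obtain P Fi where P: "P \<in> carrier_mat n n" "pos_def P"
      and bound: "\<And>x. x \<in> carrier_vec n \<Longrightarrow> x \<noteq> 0\<^sub>v n \<Longrightarrow> r\<^sup>2 / \<delta> * (x \<bullet> (P *\<^sub>v x)) < x \<bullet> x"
      and Fi: "Fi \<in> carrier_mat (m i) n" and dec: "lyapunov_decrease n Ai (B i) (Q i) (R i) P Fi"
    proof -
      obtain P where "P \<in> ?Ps" using nonempty by blast
      then show thesis unfolding P_iff by (elim conjE bexE) (rule that, auto)
    qed
    let ?M = "Ai + B i * Fi"
    have M: "?M \<in> carrier_mat n n" using Ai Bi Fi by simp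
    note W = pos_semidef_stage_cost[OF Qi Ri Fi]
    have less: "(?M *\<^sub>v x) \<bullet> (P *\<^sub>v (?M *\<^sub>v x)) + x \<bullet> ((Q i + Fi\<^sup>T * R i * Fi) *\<^sub>v x) < x \<bullet> (P *\<^sub>v x)"
      if "x \<in> carrier_vec n" "x \<noteq> 0\<^sub>v n" for x
      using dec that decrease[OF Fi that(1)] unfolding lyapunov_decrease_def by blast
    have "0 \<le> x \<bullet> ((Q i + Fi\<^sup>T * R i * Fi) *\<^sub>v x)" if "x \<in> carrier_vec n" for x
      using W(2) that unfolding pos_semidef_def carrier_matD(1)[OF W(1)] by blast
    \<comment> \<open>Dropping the nonnegative stage cost leaves a strict Lyapunov function, so
      stability follows even where the stage cost vanishes.\<close>
    then have "(?M *\<^sub>v x) \<bullet> (P *\<^sub>v (?M *\<^sub>v x)) < x \<bullet> (P *\<^sub>v x)" if "x \<in> carrier_vec n" "x \<noteq> 0\<^sub>v n" for x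
      using less[OF that] that(1) by fastforce
    then have "schur_stable ?M" by (rule lyapunov_imp_schur_stable[OF M P])
    moreover have "worst_cost n r ?M (Q i + Fi\<^sup>T * R i * Fi) < ereal \<delta>"
      using lyapunov_imp_worst_cost_less[OF M W P assms(7,8) less bound] .
    ultimately show ?thesis using resp_iff Fi by blast
  qed
  moreover have "schur_stable (Ai + B i * Fi)" if "Fi \<in> ?resp" for Fi using that resp_iff by blast
  moreover have "\<forall>Fi\<in>?resp. \<exists>P\<in>?Ps. neg_def (block_mat4
      (- P) ((Ai + B i * Fi)\<^sup>T * P) ((psd_sqrt (Q i))\<^sup>T) ((psd_sqrt (R i) * Fi)\<^sup>T)
      (P * (Ai + B i * Fi)) (- P) (0\<^sub>m n n) (0\<^sub>m n (m i))
      (psd_sqrt (Q i)) (0\<^sub>m n n) (- 1\<^sub>m n) (0\<^sub>m n (m i))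
      (psd_sqrt (R i) * Fi) (0\<^sub>m (m i) n) (0\<^sub>m (m i) n) (- 1\<^sub>m (m i)))"
  proof
    fix Fi assume Fi: "Fi \<in> ?resp"
    then obtain P where P: "P \<in> ?Ps" and dec: "lyapunov_decrease n Ai (B i) (Q i) (R i) P Fi"
      using response by blast
    have "Fi \<in> carrier_mat (m i) n" "P \<in> carrier_mat n n" "pos_def P" using Fi P resp_iff P_iff by auto
    then show "\<exists>P\<in>?Ps. neg_def (block_mat4
      (- P) ((Ai + B i * Fi)\<^sup>T * P) ((psd_sqrt (Q i))\<^sup>T) ((psd_sqrt (R i) * Fi)\<^sup>T)
      (P * (Ai + B i * Fi)) (- P) (0\<^sub>m n n) (0\<^sub>m n (m i))
      (psd_sqrt (Q i)) (0\<^sub>m n n) (- 1\<^sub>m n) (0\<^sub>m n (m i))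
      (psd_sqrt (R i) * Fi) (0\<^sub>m (m i) n) (0\<^sub>m (m i) n) (- 1\<^sub>m (m i)))"
      using lyapunov_decrease_imp_neg_def[OF Ai Bi Qi Ri _ _ _ dec] P by blast
  qed
  ultimately show ?thesis using response by blast
qed

end
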